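(* Let $m\geq1$. Then $M_b(C_{(2^{m+1},2)})\simeq\mathbb{Z}/(2)\times\mathbb{Z}/(2)$.
   Context: A skew brace is a triple $(A,+,\circ)$ where $(A,+)$ and $(A,\circ)$ are (not necessarily abelian) groups with $a\circ(b+c)=a\circ b-a+a\circ c$ for all $a,b,c\in A$. Both groups have the same neutral element $0$. For an integer $n\geq2$ and a divisor $d$ of $n$ such that every prime divisor of $n$ divides $d$, $C_{(n,d)}$ denotes the skew brace with underlying set $\mathbb{Z}/(n)$, usual addition, and $x\circ y=x+y+dxy$. For a skew brace $Q$ and a (multiplicative) abelian group $K$, a factor set is a pair $(\alpha,\mu)$ of maps $Q\times Q\to K$ such that for all $x,y,z\in Q$: $\alpha(0,y)=\alpha(x,0)=1$, $\mu(0,y)=\mu(x,0)=1$, $\alpha(y,z)\alpha(x+y,z)^{-1}\alpha(x,y+z)\alpha(x,y)^{-1}=1$, $\mu(y,z)\mu(x\circ y,z)^{-1}\mu(x,y\circ z)\mu(x,y)^{-1}=1$, and $\alpha(y,z)\mu(x,y+z)\alpha(-x,x)=\mu(x,z)\alpha(x\circ y,-x)\alpha(x\circ y-x,x\circ z)\mu(x,y)$. Factor sets form a group $Z^2_b(Q,K)$ under pointwise multiplication. For $h:Q\to K$ put $\partial_+h(x,y)=h(y)h(x+y)^{-1}h(x)$ and $\partial_\circ h(x,y)=h(y)h(x\circ y)^{-1}h(x)$. Let $B^2_b(Q,K)=\{(\partial_+h,\partial_\circ h): h:Q\to K,\ h(0)=1\}$ and $H^2_b(Q,K)=Z^2_b(Q,K)/B^2_b(Q,K)$.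 The Schur multiplier of a finite skew brace $Q$ is $M_b(Q)=H^2_b(Q,\mathbb{C}^\times)$. *)

theory Defs
  imports Complex_Main "HOL-Algebra.Ring" "HOL-Algebra.Elementary_Groups" "HOL-Computational_Algebra.Primes"
begin

section \<open>Skew braces\<close>

text \<open>A skew brace is carried by the library's record of structures with two operations.
  The field \<open>add\<close> (written \<open>\<oplus>\<close>, with \<open>\<zero>\<close>, \<open>\<ominus>\<close>) is the operation \<open>+\<close>, and
  the field \<open>mult\<close> (written \<open>\<otimes>\<close>, with \<open>\<one>\<close>) is the operation \<open>\<circ>\<close>. Neither group is
  assumed to be abelian.\<close>

locale skew_brace =
  fixes Q :: "('a, 'q) ring_scheme" (structure)
  assumes add_group: "group (add_monoid Q)"
    and circ_group: "group Q"
    and brace: "\<lbrakk>a \<in> carrier Q; b \<in> carrier Q; c \<in> carrier Q\<rbrakk>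
      \<Longrightarrow> a \<otimes> (b \<oplus> c) = ((a \<otimes> b) \<ominus> a) \<oplus> (a \<otimes> c)"

definition C_brace :: "nat \<Rightarrow> nat \<Rightarrow> int ring" where
  "C_brace n d =
     \<lparr>carrier = {0..<int n},
      monoid.mult = (\<lambda>x y. (x + y + int d * x * y) mod int n),
      monoid.one = 0,
      ring.zero = 0,
      ring.add = (\<lambda>x y. (x + y) mod int n)\<rparr>"


section \<open>Second cohomology\<close>

text \<open>Maps on \<open>Q \<times> Q\<close> are extensional functions on the carrier, so that equality of
  cochains is equality of functions.\<close>

definition factor_set ::
  "('a, 'q) ring_scheme \<Rightarrow> ('k, 'm) monoid_scheme \<Rightarrow> ('a \<times> 'a \<Rightarrow> 'k) \<Rightarrow> ('a \<times> 'a \<Rightarrow> 'k) \<Rightarrow> bool" where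
  "factor_set Q K \<alpha> \<mu> \<longleftrightarrow>
     \<alpha> \<in> carrier Q \<times> carrier Q \<rightarrow>\<^sub>E carrier K \<and>
     \<mu> \<in> carrier Q \<times> carrier Q \<rightarrow>\<^sub>E carrier K \<and>
     (\<forall>x\<in>carrier Q. \<forall>y\<in>carrier Q. \<forall>z\<in>carrier Q.
        \<alpha> (\<zero>\<^bsub>Q\<^esub>, y) = \<one>\<^bsub>K\<^esub> \<and> \<alpha> (x, \<zero>\<^bsub>Q\<^esub>) = \<one>\<^bsub>K\<^esub> \<and>
        \<mu> (\<zero>\<^bsub>Q\<^esub>, y) = \<one>\<^bsub>K\<^esub> \<and> \<mu> (x, \<zero>\<^bsub>Q\<^esub>) = \<one>\<^bsub>K\<^esub> \<and>
        \<alpha> (y, z) \<otimes>\<^bsub>K\<^esub> inv\<^bsub>K\<^esub> \<alpha> (x \<oplus>\<^bsub>Q\<^esub> y, z) \<otimes>\<^bsub>K\<^esub> \<alpha> (x, y \<oplus>\<^bsub>Q\<^esub> z) \<otimes>\<^bsub>K\<^esub> inv\<^bsub>K\<^esub> \<alpha> (x, y) = \<one>\<^bsub>K\<^esub> \<and>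
        \<mu> (y, z) \<otimes>\<^bsub>K\<^esub> inv\<^bsub>K\<^esub> \<mu> (x \<otimes>\<^bsub>Q\<^esub> y, z) \<otimes>\<^bsub>K\<^esub> \<mu> (x, y \<otimes>\<^bsub>Q\<^esub> z) \<otimes>\<^bsub>K\<^esub> inv\<^bsub>K\<^esub> \<mu> (x, y) = \<one>\<^bsub>K\<^esub> \<and>
        \<alpha> (y, z) \<otimes>\<^bsub>K\<^esub> \<mu> (x, y \<oplus>\<^bsub>Q\<^esub> z) \<otimes>\<^bsub>K\<^esub> \<alpha> (\<ominus>\<^bsub>Q\<^esub> x, x) =
        \<mu> (x, z) \<otimes>\<^bsub>K\<^esub> \<alpha> (x \<otimes>\<^bsub>Q\<^esub> y, \<ominus>\<^bsub>Q\<^esub> x)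
          \<otimes>\<^bsub>K\<^esub> \<alpha> ((x \<otimes>\<^bsub>Q\<^esub> y) \<ominus>\<^bsub>Q\<^esub> x, x \<otimes>\<^bsub>Q\<^esub> z) \<otimes>\<^bsub>K\<^esub> \<mu> (x, y))"

definition Z2b ::
  "('a, 'q) ring_scheme \<Rightarrow> ('k, 'm) monoid_scheme \<Rightarrow> (('a \<times> 'a \<Rightarrow> 'k) \<times> ('a \<times> 'a \<Rightarrow> 'k)) monoid" where
  "Z2b Q K =
     \<lparr>carrier = {(\<alpha>, \<mu>). factor_set Q K \<alpha> \<mu>},
      monoid.mult = (\<lambda>(\<alpha>, \<mu>) (\<beta>, \<nu>).
        (\<lambda>p\<in>carrier Q \<times> carrier Q. \<alpha> p \<otimes>\<^bsub>K\<^esub> \<beta> p,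
         \<lambda>p\<in>carrier Q \<times> carrier Q. \<mu> p \<otimes>\<^bsub>K\<^esub> \<nu> p)),
      one = (\<lambda>p\<in>carrier Q \<times> carrier Q. \<one>\<^bsub>K\<^esub>, \<lambda>p\<in>carrier Q \<times> carrier Q. \<one>\<^bsub>K\<^esub>)\<rparr>"

definition cobd_add ::
  "('a, 'q) ring_scheme \<Rightarrow> ('k, 'm) monoid_scheme \<Rightarrow> ('a \<Rightarrow> 'k) \<Rightarrow> 'a \<times> 'a \<Rightarrow> 'k" where
  "cobd_add Q K h =
     (\<lambda>(x, y)\<in>carrier Q \<times> carrier Q. h y \<otimes>\<^bsub>K\<^esub> inv\<^bsub>K\<^esub> h (x \<oplus>\<^bsub>Q\<^esub> y) \<otimes>\<^bsub>K\<^esub> h x)"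

definition cobd_circ ::
  "('a, 'q) ring_scheme \<Rightarrow> ('k, 'm) monoid_scheme \<Rightarrow> ('a \<Rightarrow> 'k) \<Rightarrow> 'a \<times> 'a \<Rightarrow> 'k" where
  "cobd_circ Q K h =
     (\<lambda>(x, y)\<in>carrier Q \<times> carrier Q. h y \<otimes>\<^bsub>K\<^esub> inv\<^bsub>K\<^esub> h (x \<otimes>\<^bsub>Q\<^esub> y) \<otimes>\<^bsub>K\<^esub> h x)"

definition B2b ::
  "('a, 'q) ring_scheme \<Rightarrow> ('k, 'm) monoid_scheme \<Rightarrow> (('a \<times> 'a \<Rightarrow> 'k) \<times> ('a \<times> 'a \<Rightarrow> 'k)) set" where
  "B2b Q K = {(cobd_add Q K h, cobd_circ Q K h) | h.
     h \<in> carrier Q \<rightarrow> carrier K \<and> h \<zero>\<^bsub>Q\<^esub> = \<one>\<^bsub>K\<^esub>}"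

definition H2b ::
  "('a, 'q) ring_scheme \<Rightarrow> ('k, 'm) monoid_scheme \<Rightarrow> (('a \<times> 'a \<Rightarrow> 'k) \<times> ('a \<times> 'a \<Rightarrow> 'k)) set monoid" where
  "H2b Q K = Z2b Q K Mod B2b Q K"

definition complex_units :: "complex monoid" where
  "complex_units = \<lparr>carrier = - {0}, monoid.mult = (*), one = 1\<rparr>"

definition Schur_multiplier ::
  "('a, 'q) ring_scheme \<Rightarrow> (('a \<times> 'a \<Rightarrow> complex) \<times> ('a \<times> 'a \<Rightarrow> complex)) set monoid" where
  "Schur_multiplier Q = H2b Q complex_units"


section \<open>Well-definedness\<close>

lemma C_brace_add_group:
  assumes "n > 0"
  shows "group (add_monoid (C_brace n d))"
proof (rule groupI)
  fix x assume "x \<in> carrier (add_monoid (C_brace n d))"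
  then show "\<exists>y\<in>carrier (add_monoid (C_brace n d)).
      y \<otimes>\<^bsub>add_monoid (C_brace n d)\<^esub> x = \<one>\<^bsub>add_monoid (C_brace n d)\<^esub>"
    using assms by (intro bexI[of _ "(- x) mod int n"]) (auto simp: C_brace_def mod_simps)
qed (use assms in \<open>auto simp: C_brace_def mod_simps algebra_simps\<close>)

lemma C_brace_circ_group:
  assumes "n > 0" and "\<And>p. prime p \<Longrightarrow> p dvd n \<Longrightarrow> p dvd d"
  shows "group (C_brace n d)"
proof (rule groupI)
  fix x assume x: "x \<in> carrier (C_brace n d)"
  have "coprime (1 + int d * x) (int n)"
  proof (rule ccontr)
    assume "\<not> coprime (1 + int d * x) (int n)"
    then obtain c where c: "c dvd 1 + int d * x" "c dvd int n" "\<not> is_unit c"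
      by (rule not_coprimeE)
    have "c \<noteq> 0" using c(2) assms(1) by auto
    then obtain q where "prime q" "q dvd c" using prime_divisor_exists c(3) by blast
    then have q: "prime q" "q dvd 1 + int d * x" "q dvd int n"
      using c(1,2) dvd_trans by blast+
    from q(1) have "prime (nat q)" and q0: "q \<ge> 0"
      using prime_int_nat_transfer by blast+
    moreover have "nat q dvd n"
      using q(3) q0 by (simp add: nat_dvd_iff)
    ultimately have "nat q dvd d" using assms(2) by blast
    then have "q dvd int d" using q0 by (simp add: nat_dvd_iff)
    with q(2) have "q dvd 1"
      by (metis dvd_add_left_iff dvd_mult2)
    with q(1) show False by (meson not_prime_unit)
  qed
  then obtain u v where u: "u * (1 + int d * x) + v * int n = 1"
    using bezout_int[of "1 + int d * x" "int n"] by (auto simp: coprime_iff_gcd_eq_1)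
  let ?y = "(- x * u) mod int n"
  have "(?y + x + int d * ?y * x) mod int n = ((- x * u) + x + int d * (- x * u) * x) mod int n"
    by (simp add: mod_simps mod_add_cong mod_mult_cong)
  also have "- x * u + x + int d * (- x * u) * x = x * (1 - u * (1 + int d * x))"
    by (simp add: algebra_simps)
  also have "1 - u * (1 + int d * x) = v * int n"
    using u by linarith
  finally have "(?y + x + int d * ?y * x) mod int n = 0" by simp
  then show "\<exists>y\<in>carrier (C_brace n d). y \<otimes>\<^bsub>C_brace n d\<^esub> x = \<one>\<^bsub>C_brace n d\<^esub>"
    using assms(1) by (intro bexI[of _ ?y]) (auto simp: C_brace_def)
next
  fix x y z
  let ?n = "int n" and ?d = "int d"
  have "((x + y + ?d * x * y) mod ?n + z + ?d * ((x + y + ?d * x * y) mod ?n) * z) mod ?n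
      = ((x + y + ?d * x * y) + z + ?d * (x + y + ?d * x * y) * z) mod ?n"
    by (intro mod_add_cong mod_mult_cong) auto
  also have "\<dots> = (x + (y + z + ?d * y * z) + ?d * x * (y + z + ?d * y * z)) mod ?n"
    by (simp add: algebra_simps)
  also have "\<dots> = (x + (y + z + ?d * y * z) mod ?n + ?d * x * ((y + z + ?d * y * z) mod ?n)) mod ?n"
    by (intro mod_add_cong mod_mult_cong) auto
  finally show "x \<otimes>\<^bsub>C_brace n d\<^esub> y \<otimes>\<^bsub>C_brace n d\<^esub> z = x \<otimes>\<^bsub>C_brace n d\<^esub> (y \<otimes>\<^bsub>C_brace n d\<^esub> z)"
    by (simp add: C_brace_def)
qed (use assms in \<open>auto simp: C_brace_def\<close>)

lemma skew_brace_C_brace: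
  assumes "n \<ge> 2" and "d dvd n" and "\<And>p. prime p \<Longrightarrow> p dvd n \<Longrightarrow> p dvd d"
  shows "skew_brace (C_brace n d)"
proof -
  have n: "n > 0" using assms(1) by simp
  interpret A: group "add_monoid (C_brace n d)" by (rule C_brace_add_group[OF n])
  interpret M: group "C_brace n d" by (rule C_brace_circ_group[OF n assms(3)])
  show ?thesis
  proof
    fix a b c
    assume abc: "a \<in> carrier (C_brace n d)" "b \<in> carrier (C_brace n d)" "c \<in> carrier (C_brace n d)"
    have minus: "\<ominus>\<^bsub>C_brace n d\<^esub> a = (- a) mod int n"
      unfolding a_inv_def using abc n
      by (intro A.inv_equality) (auto simp: C_brace_def mod_simps)
    let ?n = "int n" and ?d = "int d"
    have "(a + (b + c) mod ?n + ?d * a * ((b + c) mod ?n)) mod ?n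
        = (a + (b + c) + ?d * a * (b + c)) mod ?n"
      by (intro mod_add_cong mod_mult_cong) auto
    also have "\<dots> = ((a + b + ?d * a * b) + (- a) + (a + c + ?d * a * c)) mod ?n"
      by (simp add: algebra_simps)
    also have "\<dots> = (((a + b + ?d * a * b) mod ?n + (- a) mod ?n) mod ?n
        + (a + c + ?d * a * c) mod ?n) mod ?n"
      by (simp only: mod_simps)
    finally show "a \<otimes>\<^bsub>C_brace n d\<^esub> (b \<oplus>\<^bsub>C_brace n d\<^esub> c) =
        ((a \<otimes>\<^bsub>C_brace n d\<^esub> b) \<ominus>\<^bsub>C_brace n d\<^esub> a) \<oplus>\<^bsub>C_brace n d\<^esub> (a \<otimes>\<^bsub>C_brace n d\<^esub> c)"
      unfolding a_minus_def minus by (simp add: C_brace_def)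
  qed
qed

lemma comm_group_complex_units: "comm_group complex_units"
  by (rule comm_groupI)
    (auto simp: complex_units_def intro: bexI[of _ "inverse x" for x] left_inverse)

lemma (in skew_brace) one_eq_zero: "\<one> = \<zero>"
proof -
  interpret A: group "add_monoid Q" by (rule add_group)
  interpret M: group Q by (rule circ_group)
  have z: "\<zero> \<in> carrier Q" using A.one_closed by simp
  have zz: "\<zero> \<oplus> \<zero> = \<zero>" using A.r_one[of \<zero>] z by simp
  have "\<one> \<otimes> (\<zero> \<oplus> \<zero>) = ((\<one> \<otimes> \<zero>) \<ominus> \<one>) \<oplus> (\<one> \<otimes> \<zero>)"
    using brace z by blast
  then have "\<zero> = (\<zero> \<oplus> (\<ominus> \<one>)) \<oplus> \<zero>"
    using z zz by (simp add: a_minus_def)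
  then have "\<ominus> \<one> = \<zero>"
    using A.l_one A.r_one A.inv_closed[of \<one>] by (simp add: a_inv_def)
  then show ?thesis
    using A.inv_eq_1_iff[of \<one>] by (simp add: a_inv_def)
qed

lemma (in comm_group) inv_mult4_eq:
  assumes "a \<in> carrier G" "b \<in> carrier G" "c \<in> carrier G" "d \<in> carrier G"
  shows "a \<otimes> inv b \<otimes> c \<otimes> inv d = \<one> \<longleftrightarrow> a \<otimes> c = b \<otimes> d"
proof -
  have "a \<otimes> inv b \<otimes> c \<otimes> inv d = (a \<otimes> c) \<otimes> inv (b \<otimes> d)"
    using assms by (simp add: inv_mult m_ac)
  also have "\<dots> = \<one> \<longleftrightarrow> a \<otimes> c = b \<otimes> d"
    using assms by (metis inv_closed inv_equality inv_inv m_closed r_inv)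
  finally show ?thesis .
qed

context
  fixes Q :: "('a, 'q) ring_scheme" (structure) and K :: "('k, 'm) monoid_scheme"
  assumes Q: "skew_brace Q" and K: "comm_group K"
begin

interpretation skew_brace Q by (rule Q)
interpretation A: group "add_monoid Q" by (rule add_group)
interpretation M: group Q by (rule circ_group)
interpretation K: comm_group K by (rule K)

private lemma add_closed: "x \<in> carrier Q \<Longrightarrow> y \<in> carrier Q \<Longrightarrow> x \<oplus> y \<in> carrier Q"
  using A.m_closed by simp

private lemma zero_closed: "\<zero> \<in> carrier Q"
  using A.one_closed by simp

private lemma neg_closed: "x \<in> carrier Q \<Longrightarrow> \<ominus> x \<in> carrier Q"
  using A.inv_closed by (simp add: a_inv_def)

private lemma minus_closed: "x \<in> carrier Q \<Longrightarrow> y \<in> carrier Q \<Longrightarrow> x \<ominus> y \<in> carrier Q"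
  by (simp add: a_minus_def add_closed neg_closed)

private lemmas closed = add_closed zero_closed neg_closed minus_closed

private lemma factor_setD:
  assumes "factor_set Q K \<alpha> \<mu>" "x \<in> carrier Q" "y \<in> carrier Q"
  shows "\<alpha> (x, y) \<in> carrier K" "\<mu> (x, y) \<in> carrier K"
  using assms unfolding factor_set_def by (auto intro: PiE_mem)

private lemma factor_set_iff:
  "factor_set Q K \<alpha> \<mu> \<longleftrightarrow>
     \<alpha> \<in> carrier Q \<times> carrier Q \<rightarrow>\<^sub>E carrier K \<and>
     \<mu> \<in> carrier Q \<times> carrier Q \<rightarrow>\<^sub>E carrier K \<and>
     (\<forall>x\<in>carrier Q. \<forall>y\<in>carrier Q. \<forall>z\<in>carrier Q.
        \<alpha> (\<zero>, y) = \<one>\<^bsub>K\<^esub> \<and> \<alpha> (x, \<zero>) = \<one>\<^bsub>K\<^esub> \<and> \<mu> (\<zero>, y) = \<one>\<^bsub>K\<^esub> \<and> \<mu> (x, \<zero>) = \<one>\<^bsub>K\<^esub> \<and>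
        \<alpha> (y, z) \<otimes>\<^bsub>K\<^esub> \<alpha> (x, y \<oplus> z) = \<alpha> (x \<oplus> y, z) \<otimes>\<^bsub>K\<^esub> \<alpha> (x, y) \<and>
        \<mu> (y, z) \<otimes>\<^bsub>K\<^esub> \<mu> (x, y \<otimes> z) = \<mu> (x \<otimes> y, z) \<otimes>\<^bsub>K\<^esub> \<mu> (x, y) \<and>
        \<alpha> (y, z) \<otimes>\<^bsub>K\<^esub> \<mu> (x, y \<oplus> z) \<otimes>\<^bsub>K\<^esub> \<alpha> (\<ominus> x, x) =
        \<mu> (x, z) \<otimes>\<^bsub>K\<^esub> \<alpha> (x \<otimes> y, \<ominus> x) \<otimes>\<^bsub>K\<^esub> \<alpha> ((x \<otimes> y) \<ominus> x, x \<otimes> z) \<otimes>\<^bsub>K\<^esub> \<mu> (x, y))"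
proof -
  have *: "\<phi> (y, z) \<otimes>\<^bsub>K\<^esub> inv\<^bsub>K\<^esub> \<phi> (u, z) \<otimes>\<^bsub>K\<^esub> \<phi> (x, v) \<otimes>\<^bsub>K\<^esub> inv\<^bsub>K\<^esub> \<phi> (x, y) = \<one>\<^bsub>K\<^esub>
      \<longleftrightarrow> \<phi> (y, z) \<otimes>\<^bsub>K\<^esub> \<phi> (x, v) = \<phi> (u, z) \<otimes>\<^bsub>K\<^esub> \<phi> (x, y)"
    if "\<phi> \<in> carrier Q \<times> carrier Q \<rightarrow>\<^sub>E carrier K"
      "x \<in> carrier Q" "y \<in> carrier Q" "z \<in> carrier Q" "u \<in> carrier Q" "v \<in> carrier Q"
    for \<phi> x y z u v
    by (rule K.inv_mult4_eq) (use that in \<open>auto intro: PiE_mem\<close>)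
  show ?thesis
    unfolding factor_set_def by (auto simp: * closed cong: conj_cong ball_cong)
qed

private lemma factor_set_laws:
  assumes "factor_set Q K \<alpha> \<mu>" "x \<in> carrier Q" "y \<in> carrier Q" "z \<in> carrier Q"
  shows "\<alpha> (\<zero>, y) = \<one>\<^bsub>K\<^esub>" "\<alpha> (x, \<zero>) = \<one>\<^bsub>K\<^esub>" "\<mu> (\<zero>, y) = \<one>\<^bsub>K\<^esub>" "\<mu> (x, \<zero>) = \<one>\<^bsub>K\<^esub>"
    "\<alpha> (y, z) \<otimes>\<^bsub>K\<^esub> \<alpha> (x, y \<oplus> z) = \<alpha> (x \<oplus> y, z) \<otimes>\<^bsub>K\<^esub> \<alpha> (x, y)"
    "\<mu> (y, z) \<otimes>\<^bsub>K\<^esub> \<mu> (x, y \<otimes> z) = \<mu> (x \<otimes> y, z) \<otimes>\<^bsub>K\<^esub> \<mu> (x, y)"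
    "\<alpha> (y, z) \<otimes>\<^bsub>K\<^esub> \<mu> (x, y \<oplus> z) \<otimes>\<^bsub>K\<^esub> \<alpha> (\<ominus> x, x) =
      \<mu> (x, z) \<otimes>\<^bsub>K\<^esub> \<alpha> (x \<otimes> y, \<ominus> x) \<otimes>\<^bsub>K\<^esub> \<alpha> ((x \<otimes> y) \<ominus> x, x \<otimes> z) \<otimes>\<^bsub>K\<^esub> \<mu> (x, y)"
  using assms unfolding factor_set_iff by blast+

private lemma Z2b_mult_closed:
  assumes f: "factor_set Q K \<alpha> \<mu>" and g: "factor_set Q K \<beta> \<nu>"
  shows "factor_set Q K (\<lambda>p\<in>carrier Q \<times> carrier Q. \<alpha> p \<otimes>\<^bsub>K\<^esub> \<beta> p)
    (\<lambda>p\<in>carrier Q \<times> carrier Q. \<mu> p \<otimes>\<^bsub>K\<^esub> \<nu> p)"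
proof -
  have i2: "(a \<otimes>\<^bsub>K\<^esub> a') \<otimes>\<^bsub>K\<^esub> (b \<otimes>\<^bsub>K\<^esub> b') = (a \<otimes>\<^bsub>K\<^esub> b) \<otimes>\<^bsub>K\<^esub> (a' \<otimes>\<^bsub>K\<^esub> b')"
    if "a \<in> carrier K" "a' \<in> carrier K" "b \<in> carrier K" "b' \<in> carrier K" for a a' b b'
    using that by (simp add: K.m_ac)
  note D = factor_setD[OF f] factor_setD[OF g]
  show ?thesis
    unfolding factor_set_iff
  proof (intro conjI ballI, goal_cases)
    case (7 x y z)
    show ?case
      using 7 factor_set_laws(5)[OF f 7] factor_set_laws(5)[OF g 7]
      by (simp add: closed D i2[of "\<alpha> _" "\<beta> _" "\<alpha> _" "\<beta> _"])
  next
    case (8 x y z)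
    show ?case
      using 8 factor_set_laws(6)[OF f 8] factor_set_laws(6)[OF g 8]
      by (simp add: closed D i2[of "\<mu> _" "\<nu> _" "\<mu> _" "\<nu> _"])
  next
    case (9 x y z)
    let ?L = "\<lambda>\<alpha> \<mu>. \<alpha> (y, z) \<otimes>\<^bsub>K\<^esub> \<mu> (x, y \<oplus> z) \<otimes>\<^bsub>K\<^esub> \<alpha> (\<ominus> x, x)"
    let ?R = "\<lambda>\<alpha> \<mu>. \<mu> (x, z) \<otimes>\<^bsub>K\<^esub> \<alpha> (x \<otimes> y, \<ominus> x) \<otimes>\<^bsub>K\<^esub> \<alpha> ((x \<otimes> y) \<ominus> x, x \<otimes> z) \<otimes>\<^bsub>K\<^esub> \<mu> (x, y)"
    let ?\<phi> = "\<lambda>p. \<alpha> p \<otimes>\<^bsub>K\<^esub> \<beta> p" and ?\<psi> = "\<lambda>p. \<mu> p \<otimes>\<^bsub>K\<^esub> \<nu> p"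
    have "?L ?\<phi> ?\<psi> = ?L \<alpha> \<mu> \<otimes>\<^bsub>K\<^esub> ?L \<beta> \<nu>"
      using 9 by (simp add: closed D K.m_ac)
    also have "\<dots> = ?R \<alpha> \<mu> \<otimes>\<^bsub>K\<^esub> ?R \<beta> \<nu>"
      by (simp only: factor_set_laws(7)[OF f 9] factor_set_laws(7)[OF g 9])
    also have "\<dots> = ?R ?\<phi> ?\<psi>"
      using 9 by (simp add: closed D K.m_ac)
    finally show ?case using 9 by (simp add: closed)
  qed (auto simp: closed D factor_set_laws[OF f] factor_set_laws[OF g])
qed

private lemma Z2b_inv_closed:
  assumes f: "factor_set Q K \<alpha> \<mu>"
  shows "factor_set Q K (\<lambda>p\<in>carrier Q \<times> carrier Q. inv\<^bsub>K\<^esub> \<alpha> p)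
    (\<lambda>p\<in>carrier Q \<times> carrier Q. inv\<^bsub>K\<^esub> \<mu> p)"
proof -
  note D = factor_setD[OF f]
  show ?thesis
    unfolding factor_set_iff
  proof (intro conjI ballI, goal_cases)
    case (7 x y z)
    show ?case
      using 7 factor_set_laws(5)[OF f 7] by (simp add: closed D K.inv_mult[symmetric])
  next
    case (8 x y z)
    show ?case
      using 8 factor_set_laws(6)[OF f 8] by (simp add: closed D K.inv_mult[symmetric])
  next
    case (9 x y z)
    show ?case
      using 9 factor_set_laws(7)[OF f 9] by (simp add: closed D K.inv_mult[symmetric])
  qed (auto simp: closed D factor_set_laws[OF f])
qed

lemma comm_group_Z2b: "comm_group (Z2b Q K)"
proof (rule comm_groupI)
  fix x assume "x \<in> carrier (Z2b Q K)"
  then obtain \<alpha> \<mu> where x: "x = (\<alpha>, \<mu>)" and f: "factor_set Q K \<alpha> \<mu>"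
    by (auto simp: Z2b_def)
  show "\<exists>y\<in>carrier (Z2b Q K). y \<otimes>\<^bsub>Z2b Q K\<^esub> x = \<one>\<^bsub>Z2b Q K\<^esub>"
    using Z2b_inv_closed[OF f] factor_setD[OF f]
    by (intro bexI[of _ "(\<lambda>p\<in>carrier Q \<times> carrier Q. inv\<^bsub>K\<^esub> \<alpha> p,
        \<lambda>p\<in>carrier Q \<times> carrier Q. inv\<^bsub>K\<^esub> \<mu> p)"])
      (auto simp: Z2b_def x fun_eq_iff restrict_def)
  show "\<one>\<^bsub>Z2b Q K\<^esub> \<otimes>\<^bsub>Z2b Q K\<^esub> x = x"
    using f factor_setD[OF f]
    by (auto simp: Z2b_def x fun_eq_iff restrict_def factor_set_iff PiE_def extensional_def)
next
  show "\<one>\<^bsub>Z2b Q K\<^esub> \<in> carrier (Z2b Q K)"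
    by (auto simp: Z2b_def factor_set_iff closed)
next
  fix x y assume "x \<in> carrier (Z2b Q K)" "y \<in> carrier (Z2b Q K)"
  then show "x \<otimes>\<^bsub>Z2b Q K\<^esub> y \<in> carrier (Z2b Q K)"
    using Z2b_mult_closed by (auto simp: Z2b_def)
next
  fix x y assume "x \<in> carrier (Z2b Q K)" "y \<in> carrier (Z2b Q K)"
  then show "x \<otimes>\<^bsub>Z2b Q K\<^esub> y = y \<otimes>\<^bsub>Z2b Q K\<^esub> x"
    by (auto simp: Z2b_def fun_eq_iff restrict_def K.m_comm factor_setD)
next
  fix x y z assume "x \<in> carrier (Z2b Q K)" "y \<in> carrier (Z2b Q K)" "z \<in> carrier (Z2b Q K)"
  then show "x \<otimes>\<^bsub>Z2b Q K\<^esub> y \<otimes>\<^bsub>Z2b Q K\<^esub> z = x \<otimes>\<^bsub>Z2b Q K\<^esub> (y \<otimes>\<^bsub>Z2b Q K\<^esub> z)"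
    by (auto simp: Z2b_def fun_eq_iff restrict_def K.m_assoc factor_setD)
qed

private lemma cobd_factor_set:
  assumes h: "h \<in> carrier Q \<rightarrow> carrier K" and h0: "h \<zero> = \<one>\<^bsub>K\<^esub>"
  shows "factor_set Q K (cobd_add Q K h) (cobd_circ Q K h)"
proof -
  have hc: "x \<in> carrier Q \<Longrightarrow> h x \<in> carrier K" for x using h by auto
  have ad: "cobd_add Q K h (x, y) = h y \<otimes>\<^bsub>K\<^esub> inv\<^bsub>K\<^esub> h (x \<oplus> y) \<otimes>\<^bsub>K\<^esub> h x"
    and ci: "cobd_circ Q K h (x, y) = h y \<otimes>\<^bsub>K\<^esub> inv\<^bsub>K\<^esub> h (x \<otimes> y) \<otimes>\<^bsub>K\<^esub> h x"
    if "x \<in> carrier Q" "y \<in> carrier Q" for x y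
    using that by (auto simp: cobd_add_def cobd_circ_def)
  have cancel: "a \<otimes>\<^bsub>K\<^esub> (inv\<^bsub>K\<^esub> a \<otimes>\<^bsub>K\<^esub> b) = b" "inv\<^bsub>K\<^esub> a \<otimes>\<^bsub>K\<^esub> (a \<otimes>\<^bsub>K\<^esub> b) = b"
    if "a \<in> carrier K" "b \<in> carrier K" for a b
    using that by (simp_all add: K.m_assoc[symmetric])
  have cocycle: "(c \<otimes>\<^bsub>K\<^esub> inv\<^bsub>K\<^esub> e \<otimes>\<^bsub>K\<^esub> b) \<otimes>\<^bsub>K\<^esub> (e \<otimes>\<^bsub>K\<^esub> inv\<^bsub>K\<^esub> g \<otimes>\<^bsub>K\<^esub> a)
      = (c \<otimes>\<^bsub>K\<^esub> inv\<^bsub>K\<^esub> g \<otimes>\<^bsub>K\<^esub> d) \<otimes>\<^bsub>K\<^esub> (b \<otimes>\<^bsub>K\<^esub> inv\<^bsub>K\<^esub> d \<otimes>\<^bsub>K\<^esub> a)"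
    if "a \<in> carrier K" "b \<in> carrier K" "c \<in> carrier K" "d \<in> carrier K" "e \<in> carrier K" "g \<in> carrier K"
    for a b c d e g
  proof -
    have "(c \<otimes>\<^bsub>K\<^esub> inv\<^bsub>K\<^esub> e \<otimes>\<^bsub>K\<^esub> b) \<otimes>\<^bsub>K\<^esub> (e \<otimes>\<^bsub>K\<^esub> inv\<^bsub>K\<^esub> g \<otimes>\<^bsub>K\<^esub> a)
        = e \<otimes>\<^bsub>K\<^esub> (inv\<^bsub>K\<^esub> e \<otimes>\<^bsub>K\<^esub> (a \<otimes>\<^bsub>K\<^esub> (b \<otimes>\<^bsub>K\<^esub> (c \<otimes>\<^bsub>K\<^esub> inv\<^bsub>K\<^esub> g))))"
      using that by (simp add: K.m_ac)
    also have "\<dots> = d \<otimes>\<^bsub>K\<^esub> (inv\<^bsub>K\<^esub> d \<otimes>\<^bsub>K\<^esub> (a \<otimes>\<^bsub>K\<^esub> (b \<otimes>\<^bsub>K\<^esub> (c \<otimes>\<^bsub>K\<^esub> inv\<^bsub>K\<^esub> g))))"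
      using that by (simp add: cancel)
    also have "\<dots> = (c \<otimes>\<^bsub>K\<^esub> inv\<^bsub>K\<^esub> g \<otimes>\<^bsub>K\<^esub> d) \<otimes>\<^bsub>K\<^esub> (b \<otimes>\<^bsub>K\<^esub> inv\<^bsub>K\<^esub> d \<otimes>\<^bsub>K\<^esub> a)"
      using that by (simp add: K.m_ac)
    finally show ?thesis .
  qed
  have mixed: "(c \<otimes>\<^bsub>K\<^esub> inv\<^bsub>K\<^esub> e \<otimes>\<^bsub>K\<^esub> b) \<otimes>\<^bsub>K\<^esub> (e \<otimes>\<^bsub>K\<^esub> inv\<^bsub>K\<^esub> g \<otimes>\<^bsub>K\<^esub> a) \<otimes>\<^bsub>K\<^esub> (a \<otimes>\<^bsub>K\<^esub> inv\<^bsub>K\<^esub> \<one>\<^bsub>K\<^esub> \<otimes>\<^bsub>K\<^esub> n)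
      = (c \<otimes>\<^bsub>K\<^esub> inv\<^bsub>K\<^esub> s \<otimes>\<^bsub>K\<^esub> a) \<otimes>\<^bsub>K\<^esub> (n \<otimes>\<^bsub>K\<^esub> inv\<^bsub>K\<^esub> t \<otimes>\<^bsub>K\<^esub> u) \<otimes>\<^bsub>K\<^esub> (s \<otimes>\<^bsub>K\<^esub> inv\<^bsub>K\<^esub> g \<otimes>\<^bsub>K\<^esub> t)
        \<otimes>\<^bsub>K\<^esub> (b \<otimes>\<^bsub>K\<^esub> inv\<^bsub>K\<^esub> u \<otimes>\<^bsub>K\<^esub> a)"
    if "a \<in> carrier K" "b \<in> carrier K" "c \<in> carrier K" "e \<in> carrier K" "g \<in> carrier K"
      "n \<in> carrier K" "s \<in> carrier K" "t \<in> carrier K" "u \<in> carrier K"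
    for a b c e g n s t u
  proof -
    let ?r = "a \<otimes>\<^bsub>K\<^esub> (a \<otimes>\<^bsub>K\<^esub> (b \<otimes>\<^bsub>K\<^esub> (c \<otimes>\<^bsub>K\<^esub> (n \<otimes>\<^bsub>K\<^esub> inv\<^bsub>K\<^esub> g))))"
    have "(c \<otimes>\<^bsub>K\<^esub> inv\<^bsub>K\<^esub> e \<otimes>\<^bsub>K\<^esub> b) \<otimes>\<^bsub>K\<^esub> (e \<otimes>\<^bsub>K\<^esub> inv\<^bsub>K\<^esub> g \<otimes>\<^bsub>K\<^esub> a) \<otimes>\<^bsub>K\<^esub> (a \<otimes>\<^bsub>K\<^esub> inv\<^bsub>K\<^esub> \<one>\<^bsub>K\<^esub> \<otimes>\<^bsub>K\<^esub> n)
        = e \<otimes>\<^bsub>K\<^esub> (inv\<^bsub>K\<^esub> e \<otimes>\<^bsub>K\<^esub> ?r)"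
      using that by (simp add: K.m_ac)
    also have "\<dots> = s \<otimes>\<^bsub>K\<^esub> (inv\<^bsub>K\<^esub> s \<otimes>\<^bsub>K\<^esub> (t \<otimes>\<^bsub>K\<^esub> (inv\<^bsub>K\<^esub> t \<otimes>\<^bsub>K\<^esub> (u \<otimes>\<^bsub>K\<^esub> (inv\<^bsub>K\<^esub> u \<otimes>\<^bsub>K\<^esub> ?r)))))"
      using that by (simp add: cancel)
    also have "\<dots> = (c \<otimes>\<^bsub>K\<^esub> inv\<^bsub>K\<^esub> s \<otimes>\<^bsub>K\<^esub> a) \<otimes>\<^bsub>K\<^esub> (n \<otimes>\<^bsub>K\<^esub> inv\<^bsub>K\<^esub> t \<otimes>\<^bsub>K\<^esub> u) \<otimes>\<^bsub>K\<^esub> (s \<otimes>\<^bsub>K\<^esub> inv\<^bsub>K\<^esub> g \<otimes>\<^bsub>K\<^esub> t)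
        \<otimes>\<^bsub>K\<^esub> (b \<otimes>\<^bsub>K\<^esub> inv\<^bsub>K\<^esub> u \<otimes>\<^bsub>K\<^esub> a)"
      using that by (simp add: K.m_ac)
    finally show ?thesis .
  qed
  have a0: "\<zero> \<oplus> y = y" "y \<oplus> \<zero> = y" and m0: "\<zero> \<otimes> y = y" "y \<otimes> \<zero> = y"
    if "y \<in> carrier Q" for y
    using that A.l_one[of y] A.r_one[of y] M.l_one[of y] M.r_one[of y] one_eq_zero by auto
  have neg: "\<ominus> x \<oplus> x = \<zero>" if "x \<in> carrier Q" for x
    using A.l_inv[of x] that by (simp add: a_inv_def)
  have aa: "x \<oplus> y \<oplus> z = x \<oplus> (y \<oplus> z)" if "x \<in> carrier Q" "y \<in> carrier Q" "z \<in> carrier Q" for x y z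
    using A.m_assoc[of x y z] that by simp
  show ?thesis
    unfolding factor_set_iff
  proof (intro conjI ballI)
    show "cobd_add Q K h \<in> carrier Q \<times> carrier Q \<rightarrow>\<^sub>E carrier K"
      "cobd_circ Q K h \<in> carrier Q \<times> carrier Q \<rightarrow>\<^sub>E carrier K"
      by (auto simp: cobd_add_def cobd_circ_def hc closed)
  next
    fix x y z assume xyz: "x \<in> carrier Q" "y \<in> carrier Q" "z \<in> carrier Q"
    show "cobd_add Q K h (\<zero>, y) = \<one>\<^bsub>K\<^esub>" "cobd_add Q K h (x, \<zero>) = \<one>\<^bsub>K\<^esub>"
      "cobd_circ Q K h (\<zero>, y) = \<one>\<^bsub>K\<^esub>" "cobd_circ Q K h (x, \<zero>) = \<one>\<^bsub>K\<^esub>"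
      using xyz by (simp_all add: ad ci closed a0 m0 h0 hc)
    show "cobd_add Q K h (y, z) \<otimes>\<^bsub>K\<^esub> cobd_add Q K h (x, y \<oplus> z)
        = cobd_add Q K h (x \<oplus> y, z) \<otimes>\<^bsub>K\<^esub> cobd_add Q K h (x, y)"
      using xyz by (simp only: ad closed aa) (rule cocycle; simp add: hc closed)
    show "cobd_circ Q K h (y, z) \<otimes>\<^bsub>K\<^esub> cobd_circ Q K h (x, y \<otimes> z)
        = cobd_circ Q K h (x \<otimes> y, z) \<otimes>\<^bsub>K\<^esub> cobd_circ Q K h (x, y)"
      using xyz by (simp only: ci M.m_closed M.m_assoc) (rule cocycle; simp add: hc closed)
    show "cobd_add Q K h (y, z) \<otimes>\<^bsub>K\<^esub> cobd_circ Q K h (x, y \<oplus> z) \<otimes>\<^bsub>K\<^esub> cobd_add Q K h (\<ominus> x, x) =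
        cobd_circ Q K h (x, z) \<otimes>\<^bsub>K\<^esub> cobd_add Q K h (x \<otimes> y, \<ominus> x)
          \<otimes>\<^bsub>K\<^esub> cobd_add Q K h ((x \<otimes> y) \<ominus> x, x \<otimes> z) \<otimes>\<^bsub>K\<^esub> cobd_circ Q K h (x, y)"
      using xyz
      by (simp only: ad ci closed M.m_closed neg h0 brace[of x y z] a_minus_def[of Q "x \<otimes> y" x, symmetric])
        (rule mixed; simp add: hc closed)
  qed
qed

lemma subgroup_B2b: "subgroup (B2b Q K) (Z2b Q K)"
proof -
  interpret Z: comm_group "Z2b Q K" by (rule comm_group_Z2b)
  have inter: "(a \<otimes>\<^bsub>K\<^esub> a') \<otimes>\<^bsub>K\<^esub> inv\<^bsub>K\<^esub> (b \<otimes>\<^bsub>K\<^esub> b') \<otimes>\<^bsub>K\<^esub> (c \<otimes>\<^bsub>K\<^esub> c')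
      = (a \<otimes>\<^bsub>K\<^esub> inv\<^bsub>K\<^esub> b \<otimes>\<^bsub>K\<^esub> c) \<otimes>\<^bsub>K\<^esub> (a' \<otimes>\<^bsub>K\<^esub> inv\<^bsub>K\<^esub> b' \<otimes>\<^bsub>K\<^esub> c')"
    if "a \<in> carrier K" "a' \<in> carrier K" "b \<in> carrier K" "b' \<in> carrier K" "c \<in> carrier K" "c' \<in> carrier K"
    for a a' b b' c c'
    using that by (simp add: K.inv_mult K.m_ac)
  let ?\<delta> = "\<lambda>h. (cobd_add Q K h, cobd_circ Q K h)"
  let ?C = "{h. h \<in> carrier Q \<rightarrow> carrier K \<and> h \<zero> = \<one>\<^bsub>K\<^esub>}"
  have in_Z: "?\<delta> h \<in> carrier (Z2b Q K)" if "h \<in> ?C" for h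
    using that cobd_factor_set by (simp add: Z2b_def)
  have prod: "?\<delta> h \<otimes>\<^bsub>Z2b Q K\<^esub> ?\<delta> k = ?\<delta> (\<lambda>x. h x \<otimes>\<^bsub>K\<^esub> k x)"
    if "h \<in> ?C" "k \<in> ?C" for h k
  proof -
    have "h x \<in> carrier K" "k x \<in> carrier K" if "x \<in> carrier Q" for x
      using that \<open>h \<in> ?C\<close> \<open>k \<in> ?C\<close> by auto
    then show ?thesis
      by (auto simp: Z2b_def cobd_add_def cobd_circ_def fun_eq_iff restrict_def closed inter)
  qed
  have triv: "?\<delta> (\<lambda>x. \<one>\<^bsub>K\<^esub>) = \<one>\<^bsub>Z2b Q K\<^esub>"
    by (auto simp: Z2b_def cobd_add_def cobd_circ_def fun_eq_iff restrict_def)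
  have cong: "?\<delta> h = ?\<delta> k" if "\<And>x. x \<in> carrier Q \<Longrightarrow> h x = k x" for h k
    using that by (auto simp: cobd_add_def cobd_circ_def fun_eq_iff restrict_def closed)
  have B: "B2b Q K = ?\<delta> ` ?C" by (auto simp: B2b_def)
  show ?thesis
  proof (rule Z.subgroupI)
    show "B2b Q K \<subseteq> carrier (Z2b Q K)" using in_Z B by auto
    show "B2b Q K \<noteq> {}" unfolding B by (auto intro!: exI[of _ "\<lambda>x. \<one>\<^bsub>K\<^esub>"])
  next
    fix a assume "a \<in> B2b Q K"
    then obtain h where h: "h \<in> ?C" and a: "a = ?\<delta> h" using B by auto
    let ?k = "\<lambda>x. inv\<^bsub>K\<^esub> h x"
    have k: "?k \<in> ?C" using h by auto
    have "?\<delta> ?k \<otimes>\<^bsub>Z2b Q K\<^esub> ?\<delta> h = ?\<delta> (\<lambda>x. ?k x \<otimes>\<^bsub>K\<^esub> h x)" by (rule prod[OF k h])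
    also have "\<dots> = ?\<delta> (\<lambda>x. \<one>\<^bsub>K\<^esub>)" by (rule cong) (use h in \<open>auto intro!: K.l_inv\<close>)
    finally have "inv\<^bsub>Z2b Q K\<^esub> a = ?\<delta> ?k"
      unfolding a triv using in_Z[OF h] in_Z[OF k] by (rule Z.inv_equality)
    then show "inv\<^bsub>Z2b Q K\<^esub> a \<in> B2b Q K" unfolding B using k by blast
  next
    fix a b assume "a \<in> B2b Q K" "b \<in> B2b Q K"
    then obtain h k where h: "h \<in> ?C" and k: "k \<in> ?C" and ab: "a = ?\<delta> h" "b = ?\<delta> k"
      using B by auto
    have "(\<lambda>x. h x \<otimes>\<^bsub>K\<^esub> k x) \<in> ?C" using h k by auto
    then show "a \<otimes>\<^bsub>Z2b Q K\<^esub> b \<in> B2b Q K"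
      unfolding ab prod[OF h k] B by blast
  qed
qed

lemma comm_group_H2b: "comm_group (H2b Q K)"
proof -
  interpret Z: comm_group "Z2b Q K" by (rule comm_group_Z2b)
  show ?thesis
    unfolding H2b_def by (rule Z.abelian_FactGroup[OF subgroup_B2b])
qed

end

end

theory Submission
  imports Defs
begin

text \<open>Let \<open>n = 2 ^ (m + 1)\<close>. The additive group is cyclic, so \<open>\<alpha>\<close> can be made trivial by a
  coboundary. Then \<open>\<mu> (x, y) = u x powi y\<close> with \<open>u (x \<circ> y) = u y * u x powi (1 + 2 * y)\<close>, and
  commutativity of \<open>\<circ>\<close> forces \<open>u x = s powi x * v x\<close>, where \<open>s = u 1\<close> is an \<open>n\<close>-th root of unity
  and \<open>v\<close> is a homomorphism from the multiplicative group to \<open>{1, -1}\<close> with \<open>v 1 = 1\<close>. Under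
  \<open>x \<mapsto> 1 + 2 * x\<close> the multiplicative group becomes the units modulo \<open>2 * n\<close>, so
  \<open>v x = e powi (x div 2)\<close> with \<open>e = 1\<close> or \<open>e = -1\<close>. The remaining coboundaries, those of
  characters, are exactly \<open>e = 1\<close> with \<open>s\<close> the square of an \<open>n\<close>-th root of unity, which leaves
  one sign for \<open>s\<close> and one for \<open>e\<close>.\<close>

section \<open>Recognising the Klein four-group\<close>

text \<open>The hypotheses make the four listed elements distinct: \<open>x = y\<close> would give
  \<open>x \<otimes> y = x \<otimes> x = \<one>\<close>, and the other coincidences cancel to
  \<open>x = \<one>\<close> or \<open>y = \<one>\<close>.\<close>

lemma (in comm_group) Klein_four_iso:
  assumes x: "x \<in> carrier G" "x \<otimes> x = \<one>" "x \<noteq> \<one>"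
    and y: "y \<in> carrier G" "y \<otimes> y = \<one>" "y \<noteq> \<one>"
    and xy: "x \<otimes> y \<noteq> \<one>" and gen: "carrier G \<subseteq> {\<one>, x, y, x \<otimes> y}"
  shows "G \<cong> integer_mod_group 2 \<times>\<times> integer_mod_group 2"
proof -
  let ?V = "integer_mod_group 2 \<times>\<times> integer_mod_group 2"
  \<comment> \<open>The map starts from the concrete group, whose four elements can be enumerated;
    the isomorphism is reversed at the end.\<close>
  let ?F = "\<lambda>(a, b). (if a = (0::int) then \<one> else x) \<otimes> (if b = (0::int) then \<one> else y)"
  have V: "carrier ?V = {(0, 0), (0, 1), (1, 0), (1, 1)}"
    by (auto simp: DirProd_def carrier_integer_mod_group)
  have neq: "x \<noteq> y" "x \<otimes> y \<noteq> x" "x \<otimes> y \<noteq> y"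
    using x y xy by auto
  have eqs: "x \<otimes> (x \<otimes> y) = y" "y \<otimes> (x \<otimes> y) = x" "y \<otimes> x = x \<otimes> y"
      "x \<otimes> y \<otimes> x = y" "x \<otimes> y \<otimes> y = x" "x \<otimes> y \<otimes> (x \<otimes> y) = \<one>"
    using x y by (metis m_assoc m_comm l_one r_one m_closed)+
  have "?F \<in> iso ?V G"
  proof (rule isoI)
    show "?F \<in> hom ?V G"
    proof (rule homI)
      fix p q assume "p \<in> carrier ?V" "q \<in> carrier ?V"
      then show "?F (p \<otimes>\<^bsub>?V\<^esub> q) = ?F p \<otimes> ?F q"
        unfolding V using x y eqs by auto
    qed (use x y V in auto)
    show "bij_betw ?F (carrier ?V) (carrier G)"
    proof (rule bij_betwI')
      fix p q assume "p \<in> carrier ?V" "q \<in> carrier ?V"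
      then show "?F p = ?F q \<longleftrightarrow> p = q"
        unfolding V using x(1) y(1)
        by (elim insertE emptyE; simp only:)
          (simp_all add: x(3) y(3) xy neq x(3)[symmetric] y(3)[symmetric] xy[symmetric] neq[symmetric])
    next
      fix p
      show "?F p \<in> carrier G" using x(1) y(1) by (simp split: prod.split)
    next
      fix g assume "g \<in> carrier G"
      then show "\<exists>p\<in>carrier ?V. g = ?F p"
        unfolding V using gen x(1) y(1) by fastforce
    qed
  qed
  then show ?thesis
    by (meson is_isoI DirProd_group group.iso_sym group_integer_mod_group)
qed

text \<open>All conditions speak of representatives and membership in \<open>N\<close>, so that the
  cohomology group can be treated through cocycles, without cosets.\<close>

lemma (in comm_group) FactGroup_Klein_four:
  assumes N: "subgroup N G"
    and x: "x \<in> carrier G" "x \<otimes> x \<in> N" "x \<notin> N"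
    and y: "y \<in> carrier G" "y \<otimes> y \<in> N" "y \<notin> N"
    and xy: "x \<otimes> y \<notin> N"
    and gen: "\<And>g. g \<in> carrier G \<Longrightarrow> \<exists>k\<in>N. \<exists>a\<in>{\<one>, x, y, x \<otimes> y}. g = k \<otimes> a"
  shows "G Mod N \<cong> integer_mod_group 2 \<times>\<times> integer_mod_group 2"
proof -
  interpret normal N G
    using N by (simp add: normal_iff_subgroup)
  have Nc: "N \<subseteq> carrier G" using N subgroup.subset by blast
  have triv: "N #> g = N \<longleftrightarrow> g \<in> N" if "g \<in> carrier G" for g
    using coset_join1[OF _ that N] coset_join2[OF that N] Nc by blast
  have prod: "(N #> g) <#> (N #> h) = N #> (g \<otimes> h)" if "g \<in> carrier G" "h \<in> carrier G" for g h
    using that by (rule rcos_sum)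
  show ?thesis
  proof (rule comm_group.Klein_four_iso[where x = "N #> x" and y = "N #> y"])
    show "comm_group (G Mod N)" using N by (rule abelian_FactGroup)
    show "carrier (G Mod N) \<subseteq> {\<one>\<^bsub>G Mod N\<^esub>, N #> x, N #> y, (N #> x) \<otimes>\<^bsub>G Mod N\<^esub> (N #> y)}"
    proof
      fix c assume "c \<in> carrier (G Mod N)"
      then obtain g where g: "g \<in> carrier G" "c = N #> g"
        unfolding carrier_FactGroup by auto
      then obtain k a where k: "k \<in> N" "a \<in> {\<one>, x, y, x \<otimes> y}" "g = k \<otimes> a"
        using gen by blast
      then have a: "a \<in> carrier G" using x y by auto
      have "c = (N #> k) #> a"
        using g k Nc a coset_mult_assoc by auto
      also have "N #> k = N" using k Nc triv by blast
      finally have "c = N #> a" .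
      then show "c \<in> {\<one>\<^bsub>G Mod N\<^esub>, N #> x, N #> y, (N #> x) \<otimes>\<^bsub>G Mod N\<^esub> (N #> y)}"
        using k(2) prod[OF x(1) y(1)] coset_mult_one[OF Nc] by (elim insertE emptyE) simp_all
    qed
  qed (use x y xy triv prod in \<open>auto simp: carrier_FactGroup\<close>)
qed

section \<open>Explicit arithmetic in the coefficient group and in \<open>C_brace\<close>\<close>

lemma complex_units_simps [simp]:
  "carrier complex_units = - {0}" "monoid.mult complex_units = (*)" "one complex_units = 1"
  by (simp_all add: complex_units_def)

lemma inv_complex_units [simp]:
  assumes "z \<noteq> 0"
  shows "inv\<^bsub>complex_units\<^esub> z = inverse z"
proof -
  interpret comm_group complex_units by (rule comm_group_complex_units)
  show ?thesis using assms by (intro inv_equality) auto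
qed

lemma C_brace_simps [simp]:
  "carrier (C_brace n d) = {0..<int n}"
  "x \<otimes>\<^bsub>C_brace n d\<^esub> y = (x + y + int d * x * y) mod int n"
  "x \<oplus>\<^bsub>C_brace n d\<^esub> y = (x + y) mod int n"
  "\<zero>\<^bsub>C_brace n d\<^esub> = 0"
  by (simp_all add: C_brace_def)

lemma C_brace_uminus [simp]:
  assumes "x \<in> {0..<int n}"
  shows "\<ominus>\<^bsub>C_brace n d\<^esub> x = (- x) mod int n"
proof -
  interpret group "add_monoid (C_brace n d)"
    using assms by (intro C_brace_add_group) auto
  show ?thesis
    unfolding a_inv_def using assms by (intro inv_equality) (auto simp: mod_simps)
qed

text \<open>This lets the reductions modulo \<open>n\<close> in \<open>C_brace\<close> be dropped
  inside exponents of roots of unity.\<close>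

lemma powi_cong:
  fixes z :: "'a :: field"
  assumes z: "z ^ n = 1" and ij: "i mod int n = j mod int n"
  shows "z powi i = z powi j"
\<comment> \<open>Modulo 0 the congruence is equality of exponents. This case is apart because
  \<open>z\<close> may then be 0, where exponents do not add.\<close>
proof (cases "n = 0")
  case True
  then show ?thesis using ij by simp
next
  case False
  then have z0: "z \<noteq> 0" using z by (auto simp: power_0_left)
  obtain q where "i = j + int n * q"
    using ij by (metis mod_eq_dvd_iff dvd_def diff_add_cancel add.commute)
  then show ?thesis
    using z z0 by (simp add: power_int_add power_int_mult)
qed

section \<open>Triviality of additive cocycles on a cyclic group\<close>

lemma complex_nth_root_exists:
  fixes c :: complex
  assumes "c \<noteq> 0" "n > 0"
  shows "\<exists>z. z ^ n = c"
proof -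
  have "{z. z ^ n = c} \<noteq> {}"
    using card_nth_roots[OF assms] assms(2) by (metis card.empty less_irrefl)
  then show ?thesis by auto
qed

text \<open>A candidate trivialisation is forced by its value \<open>t\<close> at \<open>1\<close>; it is periodic
  precisely when \<open>t ^ n\<close> is the product of all \<open>\<alpha> (i, 1)\<close>.\<close>

lemma cyclic_cocycle_is_coboundary:
  fixes \<alpha> :: "int \<times> int \<Rightarrow> complex"
  assumes n: "n \<ge> 2"
    and nz: "\<And>x y. x \<in> {0..<int n} \<Longrightarrow> y \<in> {0..<int n} \<Longrightarrow> \<alpha> (x, y) \<noteq> 0"
    and unit: "\<And>x. x \<in> {0..<int n} \<Longrightarrow> \<alpha> (x, 0) = 1"
    and cocycle: "\<And>x y z. x \<in> {0..<int n} \<Longrightarrow> y \<in> {0..<int n} \<Longrightarrow> z \<in> {0..<int n} \<Longrightarrow>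
      \<alpha> (y, z) * \<alpha> (x, (y + z) mod int n) = \<alpha> ((x + y) mod int n, z) * \<alpha> (x, y)"
  obtains h where "h 0 = 1" "\<And>x. h x \<noteq> 0"
    "\<And>x y. x \<in> {0..<int n} \<Longrightarrow> y \<in> {0..<int n} \<Longrightarrow> \<alpha> (x, y) = h y * inverse (h ((x + y) mod int n)) * h x"
proof -
  \<comment> \<open>The index is reduced modulo \<open>n\<close> so that \<open>P\<close> is defined
    on all naturals and periodicity can be stated.\<close>
  define P where "P k = (\<Prod>i<k. \<alpha> (int i mod int n, 1))" for k
  have in_box: "j mod int n \<in> {0..<int n}" for j using n by simp
  have one: "1 \<in> {0..<int n}" using n by simp
  have Pnz: "P k \<noteq> 0" for k unfolding P_def using nz[OF in_box one] by simp
  have PSuc: "P (Suc k) = P k * \<alpha> (int k mod int n, 1)" for k by (simp add: P_def)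
  obtain t where t: "t ^ n = P n" using complex_nth_root_exists[OF Pnz[of n], of n] n by auto
  then have t0: "t \<noteq> 0" using Pnz[of n] n by (auto simp: power_0_left)
  define H where "H k = t ^ k / P k" for k
  have Hnz: "H k \<noteq> 0" for k using t0 Pnz by (simp add: H_def)
  have HSuc: "H (Suc k) = H k * t / \<alpha> (int k mod int n, 1)" for k
    by (simp add: H_def PSuc)
  have Pper: "P (k + n) = P k * P n" for k
  proof (induction k)
    case 0
    show ?case by (simp add: P_def)
  next
    case (Suc k)
    have "P (Suc k + n) = P (k + n) * \<alpha> (int k mod int n, 1)"
      using PSuc[of "k + n"] by simp
    then show ?case using Suc by (simp add: PSuc)
  qed
  have Hper: "H (k + n) = H k" for k
    unfolding H_def Pper using Pnz by (simp add: power_add t)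
  have "H (k + n * q) = H k" for k q
    by (induction q) (auto simp: Hper add.assoc[symmetric] add.commute[of n])
  then have Hmod: "H (k mod n) = H k" for k
    by (metis mod_mult_div_eq)
  have sum: "\<alpha> (int j mod int n, int k mod int n) * H (j + k) = H j * H k" for j k
  proof (induction k)
    case 0
    then show ?case using unit[OF in_box] by (simp add: H_def P_def)
  next
    case (Suc k)
    let ?j = "int j mod int n" and ?k = "int k mod int n"
    \<comment> \<open>The cocycle identity with last argument 1 passes from
      \<open>\<alpha> (j, k)\<close> to \<open>\<alpha> (j, k + 1)\<close> at the cost of two values
      \<open>\<alpha> (_, 1)\<close>, which are the factors that \<open>HSuc\<close>
      produces.\<close>
    have c: "\<alpha> (?k, 1) * \<alpha> (?j, int (Suc k) mod int n) = \<alpha> (int (j + k) mod int n, 1) * \<alpha> (?j, ?k)"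
      using cocycle[OF in_box[of "int j"] in_box[of "int k"] one] by (simp add: mod_simps add.commute)
    have z: "\<alpha> (?k, 1) \<noteq> 0" "\<alpha> (int (j + k) mod int n, 1) \<noteq> 0" by (rule nz[OF in_box one])+
    have "\<alpha> (?k, 1) * (\<alpha> (?j, int (Suc k) mod int n) * H (j + Suc k))
        = \<alpha> (int (j + k) mod int n, 1) * \<alpha> (?j, ?k) * H (Suc (j + k))"
      unfolding c[symmetric] by simp
    also have "\<dots> = \<alpha> (?j, ?k) * H (j + k) * t"
      using z(2) by (simp add: HSuc)
    also have "\<dots> = \<alpha> (?k, 1) * (H j * H (Suc k))"
      using z(1) by (simp add: HSuc Suc)
    finally show ?case using z(1) by simp
  qed
  show ?thesis
  proof (rule that[of "\<lambda>x. H (nat x)"])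
    show "H (nat 0) = 1" by (simp add: H_def P_def)
    show "H (nat x) \<noteq> 0" for x by (rule Hnz)
    fix x y assume xy: "x \<in> {0..<int n}" "y \<in> {0..<int n}"
    have "nat ((x + y) mod int n) = (nat x + nat y) mod n"
      using xy by (simp add: nat_mod_distrib nat_add_distrib)
    moreover have "\<alpha> (x, y) * H (nat x + nat y) = H (nat x) * H (nat y)"
      using sum[of "nat x" "nat y"] xy by simp
    ultimately show "\<alpha> (x, y) = H (nat y) * inverse (H (nat ((x + y) mod int n))) * H (nat x)"
      using Hnz by (simp add: Hmod field_simps)
  qed
qed

section \<open>Homomorphisms from the multiplicative group to signs\<close>

text \<open>Hensel lifting: the derivative \<open>2 * y + 1\<close> of \<open>y * (y + 1)\<close> is
  odd, so a solution modulo a power of 2 can be corrected to one modulo the next.\<close>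

lemma triangular_residues:
  "\<exists>y::int. y * (y + 1) mod 2 ^ Suc k = 2 * t mod 2 ^ Suc k"
proof (induction k)
  case 0
  show ?case by (rule exI[of _ 0]) simp
next
  case (Suc k)
  then obtain y where "y * (y + 1) mod 2 ^ Suc k = 2 * t mod 2 ^ Suc k" by blast
  then obtain s where s: "y * (y + 1) = 2 * t + 2 ^ Suc k * s"
    by (metis mod_eq_dvd_iff dvd_def diff_add_cancel add.commute)
  \<comment> \<open>Shifting \<open>y\<close> by its own defect suffices:
    \<open>s + s * (2 * y + 1)\<close> is even, which gains one more factor 2.\<close>
  let ?z = "y + 2 ^ Suc k * s"
  have "?z * (?z + 1) = y * (y + 1) + 2 ^ Suc k * s * (2 * y + 1) + 2 ^ Suc k * 2 ^ Suc k * s * s"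
    by (simp add: algebra_simps)
  also have "\<dots> = 2 * t + 2 ^ Suc (Suc k) * (s * (1 + y) + 2 ^ k * s * s)"
    unfolding s by (simp add: algebra_simps)
  finally have "?z * (?z + 1) mod 2 ^ Suc (Suc k) = 2 * t mod 2 ^ Suc (Suc k)" by simp
  then show ?case by blast
qed

text \<open>Both sides are the second binary digit of \<open>j\<close>; the right side shows that it
  survives reduction modulo a multiple of 4.\<close>

lemma half_mod_2: "j div 2 mod 2 = j mod 4 div (2::int)"
  using zmod_zmult2_eq[of 2 j 2] by simp

text \<open>A homomorphism to \<open>{1, -1}\<close> kills the squares \<open>x \<circ> x = 2x(x + 1)\<close>, and these are
  all the multiples of \<open>4\<close>.\<close>

lemma sign_hom_C_brace:
  fixes v :: "int \<Rightarrow> complex"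
  assumes n: "n = 2 ^ (m + 1)" and m: "m \<ge> 1"
    and sign: "\<And>x. x \<in> {0..<int n} \<Longrightarrow> v x * v x = 1"
    and hom: "\<And>x y. x \<in> {0..<int n} \<Longrightarrow> y \<in> {0..<int n} \<Longrightarrow>
      v ((x + y + 2 * x * y) mod int n) = v x * v y"
    and one: "v 1 = 1" and x: "x \<in> {0..<int n}"
  shows "v x = v 2 powi (x div 2)"
proof -
  have n4: "(4::int) dvd int n"
  proof -
    have "(2::int) ^ 2 dvd 2 ^ (m + 1)" using m by (intro le_imp_power_dvd) simp
    then show ?thesis by (simp add: n)
  qed
  have n0: "int n \<ge> 4" using zdvd_imp_le[OF n4] n by simp
  have in_box: "j mod int n \<in> {0..<int n}" for j using n0 by simp
  have box: "1 \<in> {0..<int n}" "2 \<in> {0..<int n}" using n0 by auto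
  have four: "v w = 1" if w: "w \<in> {0..<int n}" "w mod 4 = 0" for w
  proof -
    obtain t where t: "w = 4 * t" using w(2) by (metis mod_0_imp_dvd dvd_def)
    \<comment> \<open>With this \<open>y\<close>, the square
      \<open>y \<circ> y = 2 * y * (y + 1)\<close> is congruent to \<open>4 * t = w\<close> modulo
      \<open>n\<close>.\<close>
    obtain y :: int where "y * (y + 1) mod 2 ^ Suc m = 2 * t mod 2 ^ Suc m"
      using triangular_residues by blast
    then have y: "y * (y + 1) mod int n = 2 * t mod int n" by (simp add: n)
    let ?y = "y mod int n"
    have "(?y + ?y + 2 * ?y * ?y) mod int n = (y + y + 2 * y * y) mod int n"
      by (intro mod_add_cong mod_mult_cong) auto
    also have "\<dots> = 2 * (y * (y + 1)) mod int n" by (simp add: algebra_simps)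
    also have "\<dots> = 2 * (2 * t) mod int n" using y by (metis mod_mult_right_eq)
    also have "\<dots> = w" using w(1) t by simp
    finally have "v w = v ?y * v ?y" using hom[OF in_box in_box, of y y] by simp
    then show ?thesis using sign[OF in_box] by simp
  qed
  have mod4: "k mod int n mod 4 = k mod 4" for k using n4 by (rule mod_mod_cancel)
  have cases1: "v w = 1" if "w \<in> {0..<int n}" "w mod 4 = 1" for w
  proof -
    \<comment> \<open>Here \<open>w \<circ> 1 = 3 * w + 1\<close> is a multiple of 4, and
      \<open>v 1 = 1\<close>.\<close>
    have "(w + 1 + 2 * w * 1) mod int n mod 4 = 0" using that(2) unfolding mod4 by presburger
    then show ?thesis using four[OF in_box] hom[OF that(1) box(1)] one by simp
  qed
  have cases2: "v w = v 2" if "w \<in> {0..<int n}" "w mod 4 = 2 \<or> w mod 4 = 3" for w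
  proof -
    \<comment> \<open>Since \<open>w \<circ> 2 = 5 * w + 2\<close> is congruent to
      \<open>w + 2\<close> modulo 4, multiplying by 2 moves the classes 2 and 3 to the classes 0 and
      1 already settled.\<close>
    have "(w + 2) mod 4 = 0 \<or> (w + 2) mod 4 = 1" using that(2) by presburger
    moreover have "(w + 2 + 2 * w * 2) mod int n mod 4 = (w + 2) mod 4"
      unfolding mod4 using mod_mult_self1[of "w + 2" w 4] by (simp add: algebra_simps)
    ultimately have "(w + 2 + 2 * w * 2) mod int n mod 4 = 0 \<or> (w + 2 + 2 * w * 2) mod int n mod 4 = 1"
      by simp
    then have "v w * v 2 = 1" using four[OF in_box] cases1[OF in_box] hom[OF that(1) box(2)] by metis
    then show ?thesis using sign[OF box(2)] by (metis mult_cancel_right mult_zero_right zero_neq_one)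
  qed
  have v2: "v 2 ^ 2 = 1" using sign[OF box(2)] by (simp add: power2_eq_square)
  have "x mod 4 = 0 \<or> x mod 4 = 1 \<or> (x mod 4 = 2 \<or> x mod 4 = 3)" by presburger
  then have half: "x mod 4 = 0 \<and> x div 2 mod 2 = 0 \<or> x mod 4 = 1 \<and> x div 2 mod 2 = 0 \<or>
      (x mod 4 = 2 \<or> x mod 4 = 3) \<and> x div 2 mod 2 = 1"
    unfolding half_mod_2 by auto
  consider "v x = 1" "x div 2 mod 2 = 0" | "v x = v 2" "x div 2 mod 2 = 1"
    using four[OF x] cases1[OF x] cases2[OF x] half by blast
  then show ?thesis
  proof cases
    case 1
    then show ?thesis using powi_cong[OF v2, of "x div 2" 0] by simp
  next
    case 2
    then show ?thesis using powi_cong[OF v2, of "x div 2" 1] by simp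
  qed
qed

section \<open>Factor sets of \<open>C_brace\<close> and the standard cocycles\<close>

text \<open>All values are nonzero, so the inverses in the cocycle conditions can be cleared,
  leaving equations between products of complex numbers.\<close>

lemma factor_set_C_brace_iff:
  assumes n: "n > 0"
  shows "factor_set (C_brace n d) complex_units \<alpha> \<mu> \<longleftrightarrow>
     \<alpha> \<in> {0..<int n} \<times> {0..<int n} \<rightarrow>\<^sub>E - {0} \<and>
     \<mu> \<in> {0..<int n} \<times> {0..<int n} \<rightarrow>\<^sub>E - {0} \<and>
     (\<forall>x\<in>{0..<int n}. \<forall>y\<in>{0..<int n}. \<forall>z\<in>{0..<int n}.
        \<alpha> (0, y) = 1 \<and> \<alpha> (x, 0) = 1 \<and> \<mu> (0, y) = 1 \<and> \<mu> (x, 0) = 1 \<and>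
        \<alpha> (y, z) * \<alpha> (x, (y + z) mod int n) = \<alpha> ((x + y) mod int n, z) * \<alpha> (x, y) \<and>
        \<mu> (y, z) * \<mu> (x, (y + z + int d * y * z) mod int n) =
          \<mu> ((x + y + int d * x * y) mod int n, z) * \<mu> (x, y) \<and>
        \<alpha> (y, z) * \<mu> (x, (y + z) mod int n) * \<alpha> ((- x) mod int n, x) =
        \<mu> (x, z) * \<alpha> ((x + y + int d * x * y) mod int n, (- x) mod int n)
          * \<alpha> (((x + y + int d * x * y) mod int n + (- x) mod int n) mod int n, (x + z + int d * x * z) mod int n)
          * \<mu> (x, y))"
proof -
  have in_box: "j mod int n \<in> {0..<int n}" for j using n by simp
  have eq: "a * inverse b * c * inverse d = 1 \<longleftrightarrow> a * c = b * d" if "b \<noteq> 0" "d \<noteq> 0" for a b c d :: complex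
    using that by (simp add: field_simps)
  show ?thesis
    unfolding factor_set_def C_brace_simps complex_units_simps a_minus_def
  proof (intro conj_cong refl ball_cong)
    fix x y z
    assume \<alpha>: "\<alpha> \<in> {0..<int n} \<times> {0..<int n} \<rightarrow>\<^sub>E - {0}"
      and \<mu>: "\<mu> \<in> {0..<int n} \<times> {0..<int n} \<rightarrow>\<^sub>E - {0}"
      and xyz: "x \<in> {0..<int n}" "y \<in> {0..<int n}" "z \<in> {0..<int n}"
    have nz: "\<alpha> (u, v) \<noteq> 0" "\<mu> (u, v) \<noteq> 0" if "u \<in> {0..<int n}" "v \<in> {0..<int n}" for u v
      using PiE_mem[OF \<alpha>] PiE_mem[OF \<mu>] that by force+
    show "\<alpha> (y, z) * inv\<^bsub>complex_units\<^esub> \<alpha> ((x + y) mod int n, z) * \<alpha> (x, (y + z) mod int n)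
          * inv\<^bsub>complex_units\<^esub> \<alpha> (x, y) = 1 \<longleftrightarrow>
        \<alpha> (y, z) * \<alpha> (x, (y + z) mod int n) = \<alpha> ((x + y) mod int n, z) * \<alpha> (x, y)"
      using nz xyz in_box by (simp only: inv_complex_units eq simp_thms)
    show "\<mu> (y, z) * inv\<^bsub>complex_units\<^esub> \<mu> ((x + y + int d * x * y) mod int n, z)
          * \<mu> (x, (y + z + int d * y * z) mod int n) * inv\<^bsub>complex_units\<^esub> \<mu> (x, y) = 1 \<longleftrightarrow>
        \<mu> (y, z) * \<mu> (x, (y + z + int d * y * z) mod int n) =
          \<mu> ((x + y + int d * x * y) mod int n, z) * \<mu> (x, y)"
      using nz xyz in_box by (simp only: inv_complex_units eq simp_thms)
  qed (simp_all only: C_brace_uminus)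
qed

text \<open>The first factor of the second component is a bicharacter of the additive group when
  \<open>s ^ n = 1\<close>. For \<open>e = -1\<close>, the map \<open>e powi (x div 2)\<close> is
  the Jacobi symbol of -2 over \<open>1 + 2 * x\<close>, which is 1 exactly when
  \<open>1 + 2 * x\<close> is 1 or 3 modulo 8.\<close>

definition std_cocycle :: "nat \<Rightarrow> complex \<Rightarrow> complex \<Rightarrow> (int \<times> int \<Rightarrow> complex) \<times> (int \<times> int \<Rightarrow> complex)" where
  "std_cocycle n s e =
     (\<lambda>p\<in>{0..<int n} \<times> {0..<int n}. 1,
      \<lambda>(x, y)\<in>{0..<int n} \<times> {0..<int n}. s powi (x * y) * e powi (x div 2 * y))"

text \<open>With last bits \<open>i\<close> and \<open>j\<close>, addition contributes the carry
  \<open>(i + j) div 2\<close> and the product term contributes \<open>i * j\<close>. Both are 1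
  exactly when \<open>i = j = 1\<close>, so they cancel modulo 2.\<close>

lemma half_circ_parity: "(x + y + 2 * x * y) div 2 mod 2 = (x div 2 + y div 2) mod (2::int)"
proof -
  obtain a i where a: "x = 2 * a + i" "i = 0 \<or> i = 1" by (metis mult_div_mod_eq mod2_eq_if)
  obtain b j where b: "y = 2 * b + j" "j = 0 \<or> j = 1" by (metis mult_div_mod_eq mod2_eq_if)
  \<comment> \<open>This is half of the even part of the product:
    \<open>x * y = 2 * q + i * j\<close>.\<close>
  define q where "q = 2 * a * b + a * j + i * b"
  have "x + y + 2 * x * y = 2 * (a + b + 2 * q + i * j) + (i + j)"
    unfolding a(1) b(1) q_def by (simp add: algebra_simps)
  then have "(x + y + 2 * x * y) div 2 = a + b + 2 * q + (i * j + (i + j) div 2)" by simp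
  moreover have "i * j + (i + j) div 2 = 0 \<or> i * j + (i + j) div 2 = 2" using a(2) b(2) by auto
  moreover have "x div 2 = a" "y div 2 = b" using a b by auto
  ultimately show ?thesis by (elim disjE) simp_all
qed

lemma half_mod_parity:
  assumes "4 dvd (n::int)"
  shows "k mod n div 2 mod 2 = k div 2 mod 2"
proof -
  show ?thesis unfolding half_mod_2 mod_mod_cancel[OF assms] ..
qed

text \<open>With trivial \<alpha>, the mixed condition is additivity of \<mu> in its second
  argument. In the cocycle identity for \<open>\<circ>\<close> the exponents of \<open>s\<close>
  agree as integer polynomials before reduction modulo \<open>n\<close>; those of \<open>e\<close>
  agree modulo 2 by \<open>half_circ_parity\<close>.\<close>

lemma std_cocycle_closed:
  assumes n: "n > 0" "4 dvd n" and s: "s ^ n = 1" and e: "e ^ 2 = 1"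
  shows "std_cocycle n s e \<in> carrier (Z2b (C_brace n 2) complex_units)"
proof -
  have n4: "4 dvd int n" using n(2) by presburger
  then have n2: "2 dvd int n" by presburger
  have in_box: "j mod int n \<in> {0..<int n}" for j using n by simp
  have nz: "s \<noteq> 0" "e \<noteq> 0" using s e n by (auto simp: power_0_left)
  note sc = powi_cong[OF s] and ec = powi_cong[OF e, simplified]
  have smul: "s powi i * s powi j = s powi (i + j)" and emul: "e powi i * e powi j = e powi (i + j)" for i j
    using nz by (simp_all add: power_int_add)
  let ?\<mu> = "\<lambda>x y. s powi (x * y) * e powi (x div 2 * y)"
  have mm: "k mod int n mod 2 = k mod 2" for k using n2 by (rule mod_mod_cancel)
  have additive: "?\<mu> x ((y + z) mod int n) = ?\<mu> x y * ?\<mu> x z" for x y z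
  proof -
    have "s powi (x * ((y + z) mod int n)) = s powi (x * y + x * z)"
      by (rule sc) (simp add: mod_simps distrib_left)
    moreover have "e powi (x div 2 * ((y + z) mod int n)) = e powi (x div 2 * y + x div 2 * z)"
      by (rule ec) (metis mm mod_mult_right_eq distrib_left)
    ultimately show ?thesis by (simp add: smul[symmetric] emul[symmetric])
  qed
  have cocycle: "?\<mu> y z * ?\<mu> x ((y + z + 2 * y * z) mod int n) = ?\<mu> ((x + y + 2 * x * y) mod int n) z * ?\<mu> x y" for x y z
  proof -
    have S: "s powi (y * z + x * ((y + z + 2 * y * z) mod int n)) = s powi ((x + y + 2 * x * y) mod int n * z + x * y)"
    proof (rule sc)
      have "(y * z + x * ((y + z + 2 * y * z) mod int n)) mod int n = (y * z + x * (y + z + 2 * y * z)) mod int n"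
        by (metis mod_mult_right_eq mod_add_right_eq)
      also have "\<dots> = ((x + y + 2 * x * y) * z + x * y) mod int n" by (simp add: algebra_simps)
      also have "\<dots> = ((x + y + 2 * x * y) mod int n * z + x * y) mod int n"
        by (metis mod_mult_left_eq mod_add_left_eq)
      finally show "(y * z + x * ((y + z + 2 * y * z) mod int n)) mod int n
          = ((x + y + 2 * x * y) mod int n * z + x * y) mod int n" .
    qed
    \<comment> \<open>Only parities matter here: \<open>n\<close> is even, so reduction keeps the
      parity of the second argument, and 4 divides \<open>n\<close>, so it keeps the parity of the
      half.\<close>
    have E: "e powi (y div 2 * z + x div 2 * ((y + z + 2 * y * z) mod int n))
        = e powi ((x + y + 2 * x * y) mod int n div 2 * z + x div 2 * y)"
    proof (rule ec)
      have "(y div 2 * z + x div 2 * ((y + z + 2 * y * z) mod int n)) mod 2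
          = (y div 2 * z + x div 2 * (y + z + 2 * y * z)) mod 2"
        by (metis mm mod_mult_right_eq mod_add_right_eq)
      also have "y div 2 * z + x div 2 * (y + z + 2 * y * z)
          = (x div 2 + y div 2) * z + x div 2 * y + 2 * (x div 2 * y * z)"
        by (simp add: algebra_simps)
      also have "\<dots> mod 2 = ((x div 2 + y div 2) * z + x div 2 * y) mod 2" by simp
      also have "\<dots> = ((x + y + 2 * x * y) mod int n div 2 * z + x div 2 * y) mod 2"
        by (intro mod_add_cong mod_mult_cong refl) (simp add: half_mod_parity[OF n4] half_circ_parity)
      finally show "(y div 2 * z + x div 2 * ((y + z + 2 * y * z) mod int n)) mod 2
          = ((x + y + 2 * x * y) mod int n div 2 * z + x div 2 * y) mod 2" .
    qed
    have "?\<mu> y z * ?\<mu> x ((y + z + 2 * y * z) mod int n)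
        = s powi (y * z + x * ((y + z + 2 * y * z) mod int n))
          * e powi (y div 2 * z + x div 2 * ((y + z + 2 * y * z) mod int n))"
      unfolding smul[symmetric] emul[symmetric] by (simp only: mult_ac)
    also have "\<dots> = ?\<mu> ((x + y + 2 * x * y) mod int n) z * ?\<mu> x y"
      unfolding S E unfolding smul[symmetric] emul[symmetric] by (simp only: mult_ac)
    finally show ?thesis .
  qed
  have zero: "0 \<in> {0..<int n}" using n by simp
  have "factor_set (C_brace n 2) complex_units (fst (std_cocycle n s e)) (snd (std_cocycle n s e))"
    unfolding factor_set_C_brace_iff[OF n(1)]
  proof (intro conjI ballI)
    fix x y z assume xyz: "x \<in> {0..<int n}" "y \<in> {0..<int n}" "z \<in> {0..<int n}"
    note simps = std_cocycle_def fst_conv snd_conv restrict_apply mem_Sigma_iff xyz in_box zero simp_thms if_True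
      of_nat_numeral prod.case
    let ?a = "fst (std_cocycle n s e)" and ?m = "snd (std_cocycle n s e)"
    show "?a (0, y) = 1" "?a (x, 0) = 1" "?m (0, y) = 1" "?m (x, 0) = 1"
      by (simp_all only: simps) simp_all
    show "?a (y, z) * ?a (x, (y + z) mod int n) = ?a ((x + y) mod int n, z) * ?a (x, y)"
      by (simp only: simps)
    show "?m (y, z) * ?m (x, (y + z + int 2 * y * z) mod int n) =
        ?m ((x + y + int 2 * x * y) mod int n, z) * ?m (x, y)"
      by (simp only: simps cocycle)
    show "?a (y, z) * ?m (x, (y + z) mod int n) * ?a ((- x) mod int n, x) =
        ?m (x, z) * ?a ((x + y + int 2 * x * y) mod int n, (- x) mod int n)
          * ?a (((x + y + int 2 * x * y) mod int n + (- x) mod int n) mod int n, (x + z + int 2 * x * z) mod int n)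
          * ?m (x, y)"
      by (simp only: simps additive mult_1_left mult_1_right mult.commute)
  qed (use nz in \<open>auto simp: std_cocycle_def\<close>)
  then show ?thesis by (simp add: Z2b_def split_beta)
qed

lemma std_cocycle_mult:
  "std_cocycle n s e \<otimes>\<^bsub>Z2b (C_brace n 2) complex_units\<^esub> std_cocycle n s' e' = std_cocycle n (s * s') (e * e')"
  by (auto simp: std_cocycle_def Z2b_def fun_eq_iff restrict_def power_int_mult_distrib mult_ac)

lemma one_Z2b_C_brace: "\<one>\<^bsub>Z2b (C_brace n 2) complex_units\<^esub> = std_cocycle n 1 1"
  by (auto simp: std_cocycle_def Z2b_def fun_eq_iff restrict_def)

section \<open>Coboundaries among the standard cocycles\<close>

text \<open>A character of a cyclic group is determined by its value at the generator. This serves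
  both for the cochain behind a coboundary with trivial additive part and for each map
  \<open>\<mu> (x, _)\<close>.\<close>

lemma character_powi:
  fixes h :: "int \<Rightarrow> complex"
  assumes n: "n > 1" and h0: "h 0 = 1"
    and hom: "\<And>x y. x \<in> {0..<int n} \<Longrightarrow> y \<in> {0..<int n} \<Longrightarrow> h ((x + y) mod int n) = h x * h y"
  shows "x \<in> {0..<int n} \<Longrightarrow> h x = h 1 powi x" and "h 1 ^ n = 1"
proof -
  have pow: "h (int k) = h 1 ^ k" if "k < n" for k
    using that
  proof (induction k)
    case (Suc k)
    then show ?case using hom[of "int k" 1] by (simp add: add.commute mult.commute)
  qed (simp add: h0)
  show "h x = h 1 powi x" if "x \<in> {0..<int n}"
    using that pow[of "nat x"] by (simp add: power_int_nonneg_exp nat_less_iff)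
  \<comment> \<open>The last step of the cycle, from \<open>n - 1\<close> back to 0, makes
    \<open>h 1\<close> a root of unity.\<close>
  have "h 1 ^ n = h (int (n - 1)) * h 1"
    using pow[of "n - 1"] n by (simp add: power_eq_if)
  also have "\<dots> = h ((int (n - 1) + 1) mod int n)"
    using n by (intro hom[symmetric]) auto
  also have "\<dots> = 1" using n h0 by (simp add: of_nat_diff)
  finally show "h 1 ^ n = 1" .
qed

text \<open>A cochain with trivial additive coboundary is a character \<open>t powi x\<close>, whose
  other coboundary is \<open>t powi (- 2 * (x * y))\<close>. Hence \<open>e = 1\<close> and
  \<open>s\<close> is the square of an \<open>n\<close>-th root of unity; as \<open>n\<close> is
  even, this means \<open>s ^ (n div 2) = 1\<close>.\<close>

lemma std_cocycle_in_B2b_iff: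
  assumes n: "n > 0" "4 dvd n" and s: "s ^ n = 1" and e: "e ^ 2 = 1"
  shows "std_cocycle n s e \<in> B2b (C_brace n 2) complex_units \<longleftrightarrow> s ^ (n div 2) = 1 \<and> e = 1"
proof
  assume "std_cocycle n s e \<in> B2b (C_brace n 2) complex_units"
  then obtain h where h: "h \<in> {0..<int n} \<rightarrow> - {0}" "h 0 = 1"
    and a: "(\<lambda>p\<in>{0..<int n} \<times> {0..<int n}. 1) = cobd_add (C_brace n 2) complex_units h"
    and c: "(\<lambda>(x, y)\<in>{0..<int n} \<times> {0..<int n}. s powi (x * y) * e powi (x div 2 * y)) =
        cobd_circ (C_brace n 2) complex_units h"
    unfolding B2b_def std_cocycle_def by auto
  have n4: "n \<ge> 4" using n dvd_imp_le by blast
  then have n1: "n > 1" by simp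
  have in_box: "j mod int n \<in> {0..<int n}" for j using n by simp
  have hnz: "h x \<noteq> 0" if "x \<in> {0..<int n}" for x using h that by auto
  have hom: "h ((x + y) mod int n) = h x * h y" if "x \<in> {0..<int n}" "y \<in> {0..<int n}" for x y
  proof -
    have "1 = h y * inverse (h ((x + y) mod int n)) * h x"
      using fun_cong[OF a, of "(x, y)"] that hnz[OF in_box] by (simp add: cobd_add_def)
    then show ?thesis using hnz[OF in_box] by (simp add: field_simps)
  qed
  define t where "t = h 1"
  have t: "h x = t powi x" if "x \<in> {0..<int n}" for x
    unfolding t_def by (rule character_powi(1)[of n h, OF n1 h(2) _ that]) (erule (1) hom)
  have tn: "t ^ n = 1"
    unfolding t_def by (rule character_powi(2)[of n h, OF n1 h(2)]) (erule (1) hom)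
  then have t0: "t \<noteq> 0" using n by (auto simp: power_0_left)
  have quot: "t powi j * inverse (t powi l) * t powi i = t powi (j - l + i)" for i j l
    using t0 by (simp add: power_int_add power_int_diff divide_inverse)
  have key: "s powi (x * y) * e powi (x div 2 * y) = t powi (- 2 * (x * y))"
    if "x \<in> {0..<int n}" "y \<in> {0..<int n}" for x y
  proof -
    have "s powi (x * y) * e powi (x div 2 * y) = h y * inverse (h ((x + y + 2 * x * y) mod int n)) * h x"
      using fun_cong[OF c, of "(x, y)"] that hnz[OF in_box] by (simp add: cobd_circ_def)
    also have "h ((x + y + 2 * x * y) mod int n) = t powi (x + y + 2 * x * y)"
      unfolding t[OF in_box] by (rule powi_cong[OF tn]) simp
    also have "h y * inverse (t powi (x + y + 2 * x * y)) * h x = t powi (y - (x + y + 2 * x * y) + x)"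
      unfolding t[OF that(1)] t[OF that(2)] by (rule quot)
    also have "y - (x + y + 2 * x * y) + x = - 2 * (x * y)" by simp
    finally show ?thesis .
  qed
  \<comment> \<open>At \<open>x = 1\<close> the half is 0 and only \<open>s\<close> is visible;
    \<open>x = 2\<close> is the first argument that detects \<open>e\<close>.\<close>
  have s1: "s = inverse (t ^ 2)" using key[of 1 1] n4 by (simp add: power_int_minus)
  have "s ^ 2 * e = inverse (t ^ 4)" using key[of 2 1] n4 by (simp add: power_int_minus)
  then have "e = 1" using t0 by (simp add: s1 power_inverse power_mult[symmetric])
  moreover have "s ^ (n div 2) = 1"
  proof -
    have "n = 2 * (n div 2)" using n by presburger
    then have "(t ^ 2) ^ (n div 2) = 1" using tn by (metis power_mult)
    then show ?thesis by (simp add: s1 power_inverse)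
  qed
  ultimately show "s ^ (n div 2) = 1 \<and> e = 1" by simp
next
  assume se: "s ^ (n div 2) = 1 \<and> e = 1"
  have in_box: "j mod int n \<in> {0..<int n}" for j using n by simp
  \<comment> \<open>Either square root would do: \<open>t ^ n = s ^ (n div 2) = 1\<close>.\<close>
  define t where "t = csqrt s"
  have t2: "t ^ 2 = s" by (simp add: t_def)
  have tn: "t ^ n = 1"
  proof -
    have "n = 2 * (n div 2)" using n by presburger
    then show ?thesis using se t2 by (metis power_mult)
  qed
  then have t0: "t \<noteq> 0" using n by (auto simp: power_0_left)
  \<comment> \<open>The sign of the exponent makes the coboundary for \<open>\<circ>\<close> equal
    to \<open>t powi (2 * x * y) = s powi (x * y)\<close>.\<close>
  define h where "h x = t powi (- x)" for x
  have hnz: "h x \<noteq> 0" for x using t0 by (simp add: h_def)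
  have hmod: "h (x mod int n) = h x" for x
    unfolding h_def by (rule powi_cong[OF tn]) (simp add: mod_simps)
  have hadd: "h (x + y) = h x * h y" for x y
    using t0 by (simp add: h_def power_int_add[symmetric])
  have sq: "h (2 * x * y) = inverse (s powi (x * y))" for x y
    unfolding h_def t2[symmetric] by (simp add: power_int_minus power_int_power mult.assoc)
  have add: "h y * inverse (h (x + y)) * h x = 1" for x y
    using hnz by (simp add: hadd field_simps)
  have circ: "h y * inverse (h (x + y + 2 * x * y)) * h x = s powi (x * y)" for x y
  proof -
    have sum: "h (x + y + 2 * x * y) = h x * h y * inverse (s powi (x * y))"
      by (simp only: hadd sq)
    show ?thesis
      unfolding sum using hnz[of x] hnz[of y] by (simp add: field_simps)
  qed
  have "std_cocycle n s e = (cobd_add (C_brace n 2) complex_units h, cobd_circ (C_brace n 2) complex_units h)"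
    using hnz se by (auto simp: std_cocycle_def cobd_add_def cobd_circ_def fun_eq_iff restrict_def hmod add circ)
  moreover have "h 0 = 1" by (simp add: h_def)
  ultimately show "std_cocycle n s e \<in> B2b (C_brace n 2) complex_units"
    unfolding B2b_def using hnz by auto
qed

section \<open>Reduction of factor sets to standard cocycles\<close>

lemma factor_set_normal_form:
  assumes n: "n = 2 ^ (m + 1)" and m: "m \<ge> 1"
    and f: "factor_set (C_brace n 2) complex_units \<alpha> \<mu>"
    and \<alpha>: "\<And>x y. x \<in> {0..<int n} \<Longrightarrow> y \<in> {0..<int n} \<Longrightarrow> \<alpha> (x, y) = 1"
  shows "\<exists>s e. s ^ n = 1 \<and> e ^ 2 = 1 \<and> (\<alpha>, \<mu>) = std_cocycle n s e"
proof -
  have n0: "n > 0" by (simp add: n)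
  have n1: "n > 1"
    unfolding n by (rule one_less_power) simp_all
  have in_box: "j mod int n \<in> {0..<int n}" for j using n0 by simp
  have zero: "0 \<in> {0..<int n}" and one: "1 \<in> {0..<int n}" using n1 by auto
  note F = f[unfolded factor_set_C_brace_iff[OF n0]]
  have \<mu>_unit: "\<mu> (x, 0) = 1" if "x \<in> {0..<int n}" for x
    using F that zero by blast
  have cocycle: "\<mu> (y, z) * \<mu> (x, (y + z + 2 * y * z) mod int n) =
      \<mu> ((x + y + 2 * x * y) mod int n, z) * \<mu> (x, y)"
    if "x \<in> {0..<int n}" "y \<in> {0..<int n}" "z \<in> {0..<int n}" for x y z
    using F that by simp
  have additive: "\<mu> (x, (y + z) mod int n) = \<mu> (x, y) * \<mu> (x, z)"
    if xyz: "x \<in> {0..<int n}" "y \<in> {0..<int n}" "z \<in> {0..<int n}" for x y z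
  proof -
    have "\<alpha> (y, z) * \<mu> (x, (y + z) mod int n) * \<alpha> ((- x) mod int n, x) =
        \<mu> (x, z) * \<alpha> ((x + y + int 2 * x * y) mod int n, (- x) mod int n)
          * \<alpha> (((x + y + int 2 * x * y) mod int n + (- x) mod int n) mod int n, (x + z + int 2 * x * z) mod int n)
          * \<mu> (x, y)"
      using F xyz by blast
    then show ?thesis by (simp only: \<alpha> xyz in_box mult_1_left mult_1_right mult.commute)
  qed
  define u where "u x = \<mu> (x, 1)" for x
  have u: "\<mu> (x, y) = u x powi y" if "x \<in> {0..<int n}" "y \<in> {0..<int n}" for x y
    unfolding u_def
    by (rule character_powi(1)[of n "\<lambda>y. \<mu> (x, y)", OF n1 \<mu>_unit[OF that(1)] _ that(2)])
      (erule (1) additive[OF that(1)])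
  have un: "u x ^ n = 1" if "x \<in> {0..<int n}" for x
    unfolding u_def
    by (rule character_powi(2)[of n "\<lambda>y. \<mu> (x, y)", OF n1 \<mu>_unit[OF that(1)]])
      (erule (1) additive[OF that(1)])
  have u0: "u x \<noteq> 0" if "x \<in> {0..<int n}" for x
    using un[OF that] n0 by (auto simp: power_0_left)
  \<comment> \<open>This is the cocycle identity at third argument 1:
    \<open>y \<circ> 1 = y + (1 + 2 * y)\<close>, and the common factor
    \<open>\<mu> (x, y) = u x powi y\<close> cancels.\<close>
  have circ: "u ((x + y + 2 * x * y) mod int n) = u y * u x powi (1 + 2 * y)"
    if xy: "x \<in> {0..<int n}" "y \<in> {0..<int n}" for x y
  proof -
    have "\<mu> (x, (y + 1 + 2 * y * 1) mod int n) = u x powi (y + (1 + 2 * y))"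
      unfolding u[OF xy(1) in_box] by (rule powi_cong[OF un[OF xy(1)]]) simp
    also have "\<dots> = u x powi y * u x powi (1 + 2 * y)"
      using u0[OF xy(1)] by (intro power_int_add) simp
    finally have "u x powi y * u ((x + y + 2 * x * y) mod int n) = u x powi y * (u y * u x powi (1 + 2 * y))"
      using cocycle[OF xy one] unfolding u[OF xy] u_def[symmetric] by (simp only: mult_ac)
    then show ?thesis using u0[OF xy(1)] by simp
  qed
  have comm: "u x powi (2 * y) = u y powi (2 * x)"
    if xy: "x \<in> {0..<int n}" "y \<in> {0..<int n}" for x y
  proof -
    have "u y * u x powi (1 + 2 * y) = u x * u y powi (1 + 2 * x)"
      using circ[OF xy] circ[OF xy(2,1)] by (simp add: algebra_simps)
    then show ?thesis
      using u0[OF xy(1)] u0[OF xy(2)] by (simp add: power_int_add)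
  qed
  \<comment> \<open>The map \<open>u 1 powi x\<close> solves the equation \<open>circ\<close> as
    well, so \<open>v\<close> measures how far \<open>u\<close> is from this solution.\<close>
  define v where "v x = u x / u 1 powi x" for x
  have u1: "u 1 \<noteq> 0" by (rule u0[OF one])
  have sign: "v x * v x = 1" if x: "x \<in> {0..<int n}" for x
  proof -
    have "u x ^ 2 = u 1 powi (x * 2)"
      using comm[OF one x] by (simp add: mult.commute)
    also have "\<dots> = (u 1 powi x) ^ 2" by (simp add: power_int_power')
    finally show ?thesis
      using u0[OF x] u1 by (simp add: v_def power2_eq_square)
  qed
  have hom: "v ((x + y + 2 * x * y) mod int n) = v x * v y"
    if xy: "x \<in> {0..<int n}" "y \<in> {0..<int n}" for x y
  proof -
    \<comment> \<open>The exponent \<open>x \<circ> y\<close> is regrouped to match the two factors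
      on the right of \<open>circ\<close>.\<close>
    have "u 1 powi ((x + y + 2 * x * y) mod int n) = u 1 powi (y + x * (1 + 2 * y))"
      by (rule powi_cong[OF un[OF one]]) (simp add: algebra_simps)
    then have "v ((x + y + 2 * x * y) mod int n) = u y * u x powi (1 + 2 * y) / u 1 powi (y + x * (1 + 2 * y))"
      unfolding v_def circ[OF xy] by (simp only:)
    also have "u 1 powi (y + x * (1 + 2 * y)) = u 1 powi y * (u 1 powi x) powi (1 + 2 * y)"
      unfolding power_int_mult[symmetric] by (rule power_int_add) (simp add: u1)
    also have "u y * u x powi (1 + 2 * y) / \<dots> = v y * v x powi (1 + 2 * y)"
      by (simp add: v_def power_int_divide_distrib)
    \<comment> \<open>Since \<open>v x\<close> is a sign and the exponent is odd, the twist by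
      \<open>y\<close> disappears and \<open>v\<close> becomes a homomorphism.\<close>
    also have "v x powi (1 + 2 * y) = v x powi 1"
      by (rule powi_cong[of _ 2]) (use sign[OF xy(1)] in \<open>simp_all add: power2_eq_square\<close>)
    also have "v y * v x powi 1 = v x * v y" by simp
    finally show ?thesis .
  qed
  have v1: "v 1 = 1" using u1 by (simp add: v_def)
  have two: "2 \<in> {0..<int n}"
    using power_increasing[of 2 "m + 1" "2::nat"] m by (simp add: n)
  have ux: "u x = u 1 powi x * v 2 powi (x div 2)" if "x \<in> {0..<int n}" for x
    using sign_hom_C_brace[OF n m sign hom v1 that] u1 by (simp add: v_def field_simps)
  have "(\<alpha>, \<mu>) = std_cocycle n (u 1) (v 2)"
    unfolding std_cocycle_def
  proof (rule arg_cong2[of _ _ _ _ Pair])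
    have ext: "\<alpha> \<in> extensional ({0..<int n} \<times> {0..<int n})" "\<mu> \<in> extensional ({0..<int n} \<times> {0..<int n})"
      using conjunct1[OF F] conjunct1[OF conjunct2[OF F]] by (simp_all only: PiE_iff)
    show "\<alpha> = (\<lambda>p\<in>{0..<int n} \<times> {0..<int n}. 1)"
      by (rule extensionalityI[OF ext(1)]) (use \<alpha> in auto)
    show "\<mu> = (\<lambda>(x, y)\<in>{0..<int n} \<times> {0..<int n}. u 1 powi (x * y) * v 2 powi (x div 2 * y))"
    proof (rule extensionalityI[OF ext(2)])
      fix p assume "p \<in> {0..<int n} \<times> {0..<int n}"
      then obtain x y where p: "p = (x, y)" "x \<in> {0..<int n}" "y \<in> {0..<int n}" by blast
      have "\<mu> (x, y) = (u 1 powi x * v 2 powi (x div 2)) powi y"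
        using u[OF p(2,3)] ux[OF p(2)] by simp
      then show "\<mu> p = (\<lambda>(x, y)\<in>{0..<int n} \<times> {0..<int n}. u 1 powi (x * y) * v 2 powi (x div 2 * y)) p"
        using p by (simp add: power_int_mult_distrib power_int_mult)
    qed simp
  qed
  then show ?thesis
    using un[OF one] sign[OF two] by (auto simp: power2_eq_square)
qed

lemma skew_brace_C_brace_power_two: "skew_brace (C_brace (2 ^ (m + 1)) 2)"
proof (rule skew_brace_C_brace)
  show "p dvd 2" if "prime p" "p dvd 2 ^ (m + 1)" for p :: nat
    using that by (rule prime_dvd_power)
qed simp_all

text \<open>The coboundary of a cochain that trivialises \<alpha> is divided out. It changes \<mu>
  too, but the normal form applies to whatever \<mu> results.\<close>

lemma Z2b_decomposition:
  assumes n: "n = 2 ^ (m + 1)" and m: "m \<ge> 1"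
    and g: "g \<in> carrier (Z2b (C_brace n 2) complex_units)"
  shows "\<exists>k\<in>B2b (C_brace n 2) complex_units. \<exists>s e. s ^ n = 1 \<and> e ^ 2 = 1 \<and>
    g = k \<otimes>\<^bsub>Z2b (C_brace n 2) complex_units\<^esub> std_cocycle n s e"
proof -
  let ?Z = "Z2b (C_brace n 2) complex_units" and ?B = "B2b (C_brace n 2) complex_units"
  have n2: "n \<ge> 2" by (simp add: n)
  then have n0: "n > 0" by simp
  have brace: "skew_brace (C_brace n 2)"
    unfolding n by (rule skew_brace_C_brace_power_two)
  note K = comm_group_complex_units
  interpret Z: comm_group ?Z by (rule comm_group_Z2b[OF brace K])
  have B: "subgroup ?B ?Z" by (rule subgroup_B2b[OF brace K])
  obtain \<alpha> \<mu> where \<alpha>\<mu>: "g = (\<alpha>, \<mu>)" by fastforce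
  then have f: "factor_set (C_brace n 2) complex_units \<alpha> \<mu>" using g by (simp add: Z2b_def)
  note F = f[unfolded factor_set_C_brace_iff[OF n0]]
  have nz: "\<alpha> (x, y) \<noteq> 0" if "x \<in> {0..<int n}" "y \<in> {0..<int n}" for x y
    using PiE_mem[OF conjunct1[OF F], of "(x, y)"] that by simp
  obtain h where h: "h 0 = 1" "\<And>x. h x \<noteq> 0"
    and \<alpha>h: "\<And>x y. x \<in> {0..<int n} \<Longrightarrow> y \<in> {0..<int n} \<Longrightarrow> \<alpha> (x, y) = h y * inverse (h ((x + y) mod int n)) * h x"
  proof (rule cyclic_cocycle_is_coboundary[OF n2])
    show "\<alpha> (x, y) \<noteq> 0" if "x \<in> {0..<int n}" "y \<in> {0..<int n}" for x y using that by (rule nz)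
    show "\<alpha> (x, 0) = 1" if "x \<in> {0..<int n}" for x using F that by blast
    show "\<alpha> (y, z) * \<alpha> (x, (y + z) mod int n) = \<alpha> ((x + y) mod int n, z) * \<alpha> (x, y)"
      if "x \<in> {0..<int n}" "y \<in> {0..<int n}" "z \<in> {0..<int n}" for x y z using F that by blast
  qed blast
  define k where "k = (cobd_add (C_brace n 2) complex_units h, cobd_circ (C_brace n 2) complex_units h)"
  have kB: "k \<in> ?B" unfolding B2b_def k_def using h by auto
  then have kZ: "k \<in> carrier ?Z" using subgroup.subset[OF B] by blast
  define g' where "g' = inv\<^bsub>?Z\<^esub> k \<otimes>\<^bsub>?Z\<^esub> g"
  have g': "g' \<in> carrier ?Z" "g = k \<otimes>\<^bsub>?Z\<^esub> g'"
    unfolding g'_def using kZ g by (simp_all add: Z.m_assoc[symmetric])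
  obtain \<beta> \<nu> where \<beta>\<nu>: "g' = (\<beta>, \<nu>)" by fastforce
  have f': "factor_set (C_brace n 2) complex_units \<beta> \<nu>" using g'(1) \<beta>\<nu> by (simp add: Z2b_def)
  have "\<beta> (x, y) = 1" if xy: "x \<in> {0..<int n}" "y \<in> {0..<int n}" for x y
  proof -
    have "\<alpha> (x, y) = cobd_add (C_brace n 2) complex_units h (x, y) * \<beta> (x, y)"
      using g'(2) xy unfolding \<alpha>\<mu> \<beta>\<nu> k_def by (simp add: Z2b_def)
    also have "cobd_add (C_brace n 2) complex_units h (x, y) = \<alpha> (x, y)"
      using xy h by (simp add: cobd_add_def \<alpha>h)
    finally show ?thesis using nz[OF xy] by simp
  qed
  from factor_set_normal_form[OF n m f' this] show ?thesis
    using kB g'(2) unfolding \<beta>\<nu> by metis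
qed

section \<open>The four classes of standard cocycles\<close>

theorem theorem2p15:
  fixes m :: nat
  assumes "m \<ge> 1"
  shows "Schur_multiplier (C_brace (2 ^ (m + 1)) 2) \<cong> integer_mod_group 2 \<times>\<times> integer_mod_group 2"
proof -
  define n :: nat where "n = 2 ^ (m + 1)"
  let ?Z = "Z2b (C_brace n 2) complex_units" and ?B = "B2b (C_brace n 2) complex_units"
  have n2: "n \<ge> 2" by (simp add: n_def)
  then have n0: "n > 0" by simp
  have n4: "4 dvd n"
    using le_imp_power_dvd[of 2 "m + 1" "2::nat"] assms by (simp add: n_def)
  then have half: "n = (n div 2) * 2" by presburger
  have brace: "skew_brace (C_brace n 2)"
    unfolding n_def by (rule skew_brace_C_brace_power_two)
  note K = comm_group_complex_units
  interpret Z: comm_group ?Z by (rule comm_group_Z2b[OF brace K])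
  have B: "subgroup ?B ?Z" by (rule subgroup_B2b[OF brace K])
  have "n div 2 > 0" using n2 by simp
  \<comment> \<open>This is an \<open>n\<close>-th root of unity that is not the square of one, so
    it represents the nontrivial class of the parameter \<open>s\<close>.\<close>
  then obtain \<omega> :: complex where \<omega>: "\<omega> ^ (n div 2) = - 1"
    using complex_nth_root_exists[of "- 1"] by auto
  have halfpow: "z ^ n = (z ^ (n div 2)) ^ 2" for z :: complex
    using half by (metis power_mult)
  have \<omega>n: "\<omega> ^ n = 1" by (simp add: halfpow \<omega>)
  have \<omega>0: "\<omega> \<noteq> 0" using \<omega>n n0 by (auto simp: power_0_left)
  let ?x = "std_cocycle n \<omega> 1" and ?y = "std_cocycle n 1 (- 1)"
  note closed = std_cocycle_closed[OF n0 n4] and iff = std_cocycle_in_B2b_iff[OF n0 n4]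
  have "?Z Mod ?B \<cong> integer_mod_group 2 \<times>\<times> integer_mod_group 2"
  proof (rule Z.FactGroup_Klein_four[OF B, where x = ?x and y = ?y])
    show "?x \<in> carrier ?Z" "?y \<in> carrier ?Z" using \<omega>n by (auto intro!: closed)
    show "?x \<otimes>\<^bsub>?Z\<^esub> ?x \<in> ?B" "?y \<otimes>\<^bsub>?Z\<^esub> ?y \<in> ?B" "?x \<notin> ?B" "?y \<notin> ?B" "?x \<otimes>\<^bsub>?Z\<^esub> ?y \<notin> ?B"
      using \<omega> \<omega>n by (simp_all add: std_cocycle_mult iff power_mult_distrib)
    fix g assume "g \<in> carrier ?Z"
    then obtain k s e where k: "k \<in> ?B" and s: "s ^ n = 1" and e: "e ^ 2 = 1"
      and g: "g = k \<otimes>\<^bsub>?Z\<^esub> std_cocycle n s e"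
      using Z2b_decomposition[OF n_def assms] by blast
    have "(s ^ (n div 2)) ^ 2 = 1" using s halfpow by simp
    then consider "s ^ (n div 2) = 1" | "s ^ (n div 2) = - 1" by (auto simp: power2_eq_1_iff)
    \<comment> \<open>The factor \<open>r\<close> is the part of \<open>s\<close> that a coboundary
      absorbs; \<open>w\<close> is the chosen representative of the class of
      \<open>s\<close>.\<close>
    then obtain r w where rw: "s = r * w" "r ^ (n div 2) = 1" "w = 1 \<or> w = \<omega>"
    proof cases
      case 1
      then show ?thesis using that[of s 1] by simp
    next
      case 2
      then show ?thesis using that[of "s / \<omega>" \<omega>] \<omega> \<omega>0 by (simp add: power_divide)
    qed
    let ?b = "std_cocycle n r 1"
    have rn: "r ^ n = 1" by (simp add: halfpow rw)
    have wn: "w ^ n = 1" using rw(3) \<omega>n by auto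
    have b: "?b \<in> ?B" using rn rw(2) by (simp add: iff)
    have "g = (k \<otimes>\<^bsub>?Z\<^esub> ?b) \<otimes>\<^bsub>?Z\<^esub> std_cocycle n w e"
      using g k b subgroup.subset[OF B] closed[OF wn e]
      by (subst Z.m_assoc) (auto simp: std_cocycle_mult rw(1))
    moreover have "k \<otimes>\<^bsub>?Z\<^esub> ?b \<in> ?B" using subgroup.m_closed[OF B k b] .
    moreover have "e = 1 \<or> e = - 1" using e by (simp add: power2_eq_1_iff)
    then have "std_cocycle n w e \<in> {\<one>\<^bsub>?Z\<^esub>, ?x, ?y, ?x \<otimes>\<^bsub>?Z\<^esub> ?y}"
      using rw(3) by (auto simp: one_Z2b_C_brace std_cocycle_mult)
    ultimately show "\<exists>k\<in>?B. \<exists>a\<in>{\<one>\<^bsub>?Z\<^esub>, ?x, ?y, ?x \<otimes>\<^bsub>?Z\<^esub> ?y}. g = k \<otimes>\<^bsub>?Z\<^esub> a"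
      by blast
  qed
  then show ?thesis unfolding Schur_multiplier_def H2b_def n_def .
qed

end
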